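(* Let $f\colon(\mathbb{R}^2,0)\to(\mathbb{R}^3,0)$ be a frontal and $0$ a pure-frontal singular point of $f$, with principal curvatures $\kappa_1,\kappa_2$ nowhere zero. Suppose that $\kappa_t\neq0$ at $0$. Then for each $j=1,2$, the point $0$ is also a singular point of the focal surface $C_j$ if and only if $r_c=0$ holds at $0$.
   Context: All maps are $C^\infty$. A map germ $f\colon(\mathbb{R}^2,0)\to(\mathbb{R}^3,0)$ is a frontal if there is a smooth $\nu\colon(\mathbb{R}^2,0)\to\mathbb{S}^2$ (a unit normal vector field) with $\langle df_q(X),\nu(q)\rangle=0$ for all $q$ and $X\in T_q\mathbb{R}^2$. Put $\lambda=\det(f_u,f_v,\nu)$ and $S(f)=\{q: \operatorname{rank}df_q<2\}=\lambda^{-1}(0)$. A singular point is non-degenerate if $d\lambda\ne0$ there; then near it $S(f)$ is a regular curve $\gamma$ (the singular curve) and there is a nowhere vanishing vector field $\eta$ (null vector field) with $df(\eta)=0$ along $\gamma$. It is of the first kind if $\gamma'$ and $\eta$ are linearly independent there. A singular point of the first kind is a pure-frontal singular point if $\psi(t)=\det((f\circ\gamma)'(t),\nu(\gamma(t)),d\nu_{\gamma(t)}(\eta))$ vanishes identically along $\gamma$. Adapted coordinates: around a pure-frontal singular point there are coordinates $(u,v)$ with $S(f)=\{v=0\}$, $\partial_v$ a null vector field, and $\{f_u,f_{vv},\nu\}$ orthonormal along the $u$-axis; fix such coordinates. Then $f_v=vh$, $\nu_v=v\nu_1$ with $h,\nu_1$ smooth. Put $\tilde E=\langle f_u,f_u\rangle$,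 $\tilde F=\langle f_u,h\rangle$, $\tilde G=\langle h,h\rangle$, $\tilde L=-\langle f_u,\nu_u\rangle$, $\tilde M=-\langle h,\nu_u\rangle$, $\tilde N_1=-\langle h,\nu_1\rangle$. The Gaussian and mean curvatures of $f$ extend smoothly as $K=\frac{\tilde L\tilde N_1-\tilde M^2}{\tilde E\tilde G-\tilde F^2}$, $H=\frac{\tilde E\tilde N_1-2\tilde F\tilde M+\tilde G\tilde L}{2(\tilde E\tilde G-\tilde F^2)}$, and the principal curvatures are $\kappa_1=H+\sqrt{H^2-K}$, $\kappa_2=H-\sqrt{H^2-K}$ (distinct and smooth near $0$ if $\kappa_t(0)\ne0$). Along the $u$-axis, the cuspidal torsion is $\kappa_t(u)=\tilde M(u,0)$ and the secondary cuspidal curvature is $r_c(u)=24\bigl((\tilde N_1)_v-2\tilde F_v\tilde M-\tilde G_v\tilde N_1\bigr)(u,0)$. The focal surface associated to $\kappa_j$ is $C_j=f+\rho_j\nu$ with $\rho_j=1/\kappa_j$ (a map from a neighbourhood of $0$ in $\mathbb{R}^2$ to $\mathbb{R}^3$). A singular point of $C_j$ is a point where $\operatorname{rank}dC_j<2$. *)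

theory Defs
  imports "HOL-Analysis.Analysis"
begin

section \<open>Smooth maps\<close>

primrec Ck_on :: "nat \<Rightarrow> 'a::real_normed_vector set \<Rightarrow> ('a \<Rightarrow> 'b::real_normed_vector) \<Rightarrow> bool" where
  "Ck_on 0 U f \<longleftrightarrow> continuous_on U f"
| "Ck_on (Suc k) U f \<longleftrightarrow>
     (\<forall>x\<in>U. f differentiable (at x)) \<and>
     (\<forall>w. Ck_on k U (\<lambda>x. frechet_derivative f (at x) w))"

text \<open>The class of infinitely differentiable maps; only meaningful for open \<open>U\<close>.\<close>

definition smooth_on :: "'a::real_normed_vector set \<Rightarrow> ('a \<Rightarrow> 'b::real_normed_vector) \<Rightarrow> bool" where
  "smooth_on U f \<longleftrightarrow> (\<forall>k. Ck_on k U f)"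

text \<open>Coordinates on the plane: \<open>u = q $ 1\<close>, \<open>v = q $ 2\<close>.\<close>

definition pd :: "2 \<Rightarrow> (real^2 \<Rightarrow> 'b::real_normed_vector) \<Rightarrow> real^2 \<Rightarrow> 'b" where
  "pd i f q = frechet_derivative f (at q) (axis i 1)"

section \<open>Frontals and pure-frontal singular points\<close>

text \<open>A germ is represented by a total function together with an open neighbourhood \<open>U\<close> on which
  it is considered.\<close>

definition frontal_on :: "(real^2) set \<Rightarrow> (real^2 \<Rightarrow> real^3) \<Rightarrow> (real^2 \<Rightarrow> real^3) \<Rightarrow> bool" where
  "frontal_on U f \<nu> \<longleftrightarrow>
     smooth_on U f \<and> smooth_on U \<nu> \<and>
     (\<forall>q\<in>U. norm (\<nu> q) = 1 \<and> (\<forall>X. frechet_derivative f (at q) X \<bullet> \<nu> q = 0))"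

definition sing_set :: "(real^2 \<Rightarrow> real^3) \<Rightarrow> (real^2) set" where
  "sing_set f = {q. rank (jacobian f (at q)) < 2}"

definition lam :: "(real^2 \<Rightarrow> real^3) \<Rightarrow> (real^2 \<Rightarrow> real^3) \<Rightarrow> real^2 \<Rightarrow> real" where
  "lam f \<nu> q = det (vector [pd 1 f q, pd 2 f q, \<nu> q] :: real^3^3)"

definition nondegenerate_singular_point ::
    "(real^2 \<Rightarrow> real^3) \<Rightarrow> (real^2 \<Rightarrow> real^3) \<Rightarrow> real^2 \<Rightarrow> bool" where
  "nondegenerate_singular_point f \<nu> p \<longleftrightarrow>
     p \<in> sing_set f \<and> frechet_derivative (lam f \<nu>) (at p) \<noteq> (\<lambda>_. 0)"

definition singular_curve ::
    "(real^2) set \<Rightarrow> (real^2 \<Rightarrow> real^3) \<Rightarrow> real^2 \<Rightarrow> real \<Rightarrow> (real \<Rightarrow> real^2) \<Rightarrow> bool" where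
  "singular_curve U f p \<epsilon> \<gamma> \<longleftrightarrow>
     \<epsilon> > 0 \<and> smooth_on {-\<epsilon><..<\<epsilon>} \<gamma> \<and> \<gamma> 0 = p \<and>
     (\<forall>t\<in>{-\<epsilon><..<\<epsilon>}. vector_derivative \<gamma> (at t) \<noteq> 0) \<and>
     (\<exists>V. open V \<and> p \<in> V \<and> V \<subseteq> U \<and> \<gamma> ` {-\<epsilon><..<\<epsilon>} = sing_set f \<inter> V)"

definition null_vector_field ::
    "(real^2 \<Rightarrow> real^3) \<Rightarrow> real \<Rightarrow> (real \<Rightarrow> real^2) \<Rightarrow> (real^2 \<Rightarrow> real^2) \<Rightarrow> bool" where
  "null_vector_field f \<epsilon> \<gamma> \<eta> \<longleftrightarrow>
     (\<exists>V. open V \<and> \<gamma> ` {-\<epsilon><..<\<epsilon>} \<subseteq> V \<and> smooth_on V \<eta> \<and> (\<forall>q\<in>V. \<eta> q \<noteq> 0)) \<and>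
     (\<forall>t\<in>{-\<epsilon><..<\<epsilon>}. frechet_derivative f (at (\<gamma> t)) (\<eta> (\<gamma> t)) = 0)"

definition psi ::
    "(real^2 \<Rightarrow> real^3) \<Rightarrow> (real^2 \<Rightarrow> real^3) \<Rightarrow> (real \<Rightarrow> real^2) \<Rightarrow> (real^2 \<Rightarrow> real^2) \<Rightarrow> real \<Rightarrow> real" where
  "psi f \<nu> \<gamma> \<eta> t =
     det (vector [vector_derivative (f \<circ> \<gamma>) (at t), \<nu> (\<gamma> t),
                  frechet_derivative \<nu> (at (\<gamma> t)) (\<eta> (\<gamma> t))] :: real^3^3)"

text \<open>At a non-degenerate singular point \<open>\<gamma>\<close> and \<open>\<eta>\<close> always exist, and neither being of the first
  kind nor the vanishing of \<open>\<psi>\<close> near the point depends on their choice. The condition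
  \<open>\<gamma>' \<noteq> \<eta>\<close> is needed because \<open>{\<gamma>', \<eta>}\<close> is a set.\<close>

definition pure_frontal_point ::
    "(real^2) set \<Rightarrow> (real^2 \<Rightarrow> real^3) \<Rightarrow> (real^2 \<Rightarrow> real^3) \<Rightarrow> real^2 \<Rightarrow> bool" where
  "pure_frontal_point U f \<nu> p \<longleftrightarrow>
     nondegenerate_singular_point f \<nu> p \<and>
     (\<exists>\<epsilon> \<gamma> \<eta>. singular_curve U f p \<epsilon> \<gamma> \<and> null_vector_field f \<epsilon> \<gamma> \<eta> \<and>
        independent {vector_derivative \<gamma> (at 0), \<eta> p} \<and> vector_derivative \<gamma> (at 0) \<noteq> \<eta> p \<and>
        (\<forall>t\<in>{-\<epsilon><..<\<epsilon>}. psi f \<nu> \<gamma> \<eta> t = 0))"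

section \<open>Adapted coordinates\<close>

definition coordinate_change :: "(real^2) set \<Rightarrow> (real^2) set \<Rightarrow> (real^2 \<Rightarrow> real^2) \<Rightarrow> bool" where
  "coordinate_change W U \<phi> \<longleftrightarrow>
     open W \<and> \<phi> ` W \<subseteq> U \<and> open (\<phi> ` W) \<and> smooth_on W \<phi> \<and>
     (\<exists>\<phi>'. smooth_on (\<phi> ` W) \<phi>' \<and> (\<forall>q\<in>W. \<phi>' (\<phi> q) = q))"

text \<open>The map \<open>\<phi>\<close> sends the new coordinates \<open>(u, v) \<in> W\<close> to the old ones, so \<open>f\<close> and \<open>\<nu>\<close> are
  expressed in the new coordinates as \<open>f \<circ> \<phi>\<close> and \<open>\<nu> \<circ> \<phi>\<close>.\<close>

definition adapted_coordinates ::
    "(real^2) set \<Rightarrow> (real^2 \<Rightarrow> real^3) \<Rightarrow> (real^2 \<Rightarrow> real^3) \<Rightarrow> real^2 \<Rightarrow>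
     (real^2) set \<Rightarrow> (real^2 \<Rightarrow> real^2) \<Rightarrow> bool" where
  "adapted_coordinates U f \<nu> p W \<phi> \<longleftrightarrow>
     coordinate_change W U \<phi> \<and> 0 \<in> W \<and> \<phi> 0 = p \<and>
     sing_set (f \<circ> \<phi>) \<inter> W = {q \<in> W. q $ 2 = 0} \<and>
     (\<forall>q\<in>W. q $ 2 = 0 \<longrightarrow>
        (let a = pd 1 (f \<circ> \<phi>) q; b = pd 2 (pd 2 (f \<circ> \<phi>)) q; n = (\<nu> \<circ> \<phi>) q in
           pd 2 (f \<circ> \<phi>) q = 0 \<and>
           norm a = 1 \<and> norm b = 1 \<and> norm n = 1 \<and> a \<bullet> b = 0 \<and> a \<bullet> n = 0 \<and> b \<bullet> n = 0))"

section \<open>Curvatures\<close>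

text \<open>In this section \<open>f\<close> and \<open>\<nu>\<close> are expressed in adapted coordinates. For a smooth \<open>g\<close> vanishing on
  the \<open>u\<close>-axis, \<open>div_v g\<close> is the unique continuous (hence smooth) function with
  \<open>g = v \<cdot> div_v g\<close>; on the axis its value is \<open>g\<^sub>v\<close>.\<close>

definition div_v :: "(real^2 \<Rightarrow> real^3) \<Rightarrow> real^2 \<Rightarrow> real^3" where
  "div_v g q = (if q $ 2 = 0 then pd 2 g q else g q /\<^sub>R (q $ 2))"

definition h_of :: "(real^2 \<Rightarrow> real^3) \<Rightarrow> real^2 \<Rightarrow> real^3" where
  "h_of f = div_v (pd 2 f)"

definition nu1_of :: "(real^2 \<Rightarrow> real^3) \<Rightarrow> real^2 \<Rightarrow> real^3" where
  "nu1_of \<nu> = div_v (pd 2 \<nu>)"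

definition tE :: "(real^2 \<Rightarrow> real^3) \<Rightarrow> real^2 \<Rightarrow> real" where
  "tE f q = pd 1 f q \<bullet> pd 1 f q"

definition tF :: "(real^2 \<Rightarrow> real^3) \<Rightarrow> real^2 \<Rightarrow> real" where
  "tF f q = pd 1 f q \<bullet> h_of f q"

definition tG :: "(real^2 \<Rightarrow> real^3) \<Rightarrow> real^2 \<Rightarrow> real" where
  "tG f q = h_of f q \<bullet> h_of f q"

definition tL :: "(real^2 \<Rightarrow> real^3) \<Rightarrow> (real^2 \<Rightarrow> real^3) \<Rightarrow> real^2 \<Rightarrow> real" where
  "tL f \<nu> q = - (pd 1 f q \<bullet> pd 1 \<nu> q)"

definition tM :: "(real^2 \<Rightarrow> real^3) \<Rightarrow> (real^2 \<Rightarrow> real^3) \<Rightarrow> real^2 \<Rightarrow> real" where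
  "tM f \<nu> q = - (h_of f q \<bullet> pd 1 \<nu> q)"

definition tN1 :: "(real^2 \<Rightarrow> real^3) \<Rightarrow> (real^2 \<Rightarrow> real^3) \<Rightarrow> real^2 \<Rightarrow> real" where
  "tN1 f \<nu> q = - (h_of f q \<bullet> nu1_of \<nu> q)"

text \<open>Smooth extensions across the singular curve of the Gaussian and the mean curvature: the
  coefficients of the fundamental forms of \<open>f\<close> are \<open>E, vF, v\<^sup>2G\<close> and \<open>L, vM, v\<^sup>2N\<^sub>1\<close> in terms of the
  functions above, and the powers of \<open>v\<close> cancel in both quotients.\<close>

definition gauss_curvature :: "(real^2 \<Rightarrow> real^3) \<Rightarrow> (real^2 \<Rightarrow> real^3) \<Rightarrow> real^2 \<Rightarrow> real" where
  "gauss_curvature f \<nu> q =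
     (tL f \<nu> q * tN1 f \<nu> q - (tM f \<nu> q)\<^sup>2) / (tE f q * tG f q - (tF f q)\<^sup>2)"

definition mean_curvature :: "(real^2 \<Rightarrow> real^3) \<Rightarrow> (real^2 \<Rightarrow> real^3) \<Rightarrow> real^2 \<Rightarrow> real" where
  "mean_curvature f \<nu> q =
     (tE f q * tN1 f \<nu> q - 2 * tF f q * tM f \<nu> q + tG f q * tL f \<nu> q) /
     (2 * (tE f q * tG f q - (tF f q)\<^sup>2))"

text \<open>Only the indices \<open>j = 1\<close> (sign plus) and \<open>j = 2\<close> (sign minus) are meant.\<close>

definition principal_curvature ::
    "nat \<Rightarrow> (real^2 \<Rightarrow> real^3) \<Rightarrow> (real^2 \<Rightarrow> real^3) \<Rightarrow> real^2 \<Rightarrow> real" where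
  "principal_curvature j f \<nu> q =
     (if j = 1
      then mean_curvature f \<nu> q + sqrt ((mean_curvature f \<nu> q)\<^sup>2 - gauss_curvature f \<nu> q)
      else mean_curvature f \<nu> q - sqrt ((mean_curvature f \<nu> q)\<^sup>2 - gauss_curvature f \<nu> q))"

definition cuspidal_torsion :: "(real^2 \<Rightarrow> real^3) \<Rightarrow> (real^2 \<Rightarrow> real^3) \<Rightarrow> real \<Rightarrow> real" where
  "cuspidal_torsion f \<nu> u = tM f \<nu> (vector [u, 0])"

definition secondary_cuspidal_curvature ::
    "(real^2 \<Rightarrow> real^3) \<Rightarrow> (real^2 \<Rightarrow> real^3) \<Rightarrow> real \<Rightarrow> real" where
  "secondary_cuspidal_curvature f \<nu> u =
     (let q = vector [u, 0] in
        24 * (pd 2 (tN1 f \<nu>) q - 2 * pd 2 (tF f) q * tM f \<nu> q - pd 2 (tG f) q * tN1 f \<nu> q))"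

definition focal_surface ::
    "nat \<Rightarrow> (real^2 \<Rightarrow> real^3) \<Rightarrow> (real^2 \<Rightarrow> real^3) \<Rightarrow> real^2 \<Rightarrow> real^3" where
  "focal_surface j f \<nu> q = f q + (1 / principal_curvature j f \<nu> q) *\<^sub>R \<nu> q"

end

theory Submission
  imports Defs
begin

text \<open>
  Work in the adapted coordinates and write \<open>g\<close>, \<open>n\<close> for the surface and its normal. The idea is
  to compare, at the origin, the two columns \<open>C\<^sub>u = g\<^sub>u + \<rho> n\<^sub>u + \<rho>\<^sub>u n\<close> and
  \<open>C\<^sub>v = g\<^sub>v + \<rho> n\<^sub>v + \<rho>\<^sub>v n\<close> of the derivative of the focal surface. Along the \<open>u\<close>-axis
  \<open>g\<^sub>v = 0\<close>, because \<open>\<partial>\<^sub>v\<close> is null, and \<open>n\<^sub>v = 0\<close>: this is what the condition \<open>\<psi> = 0\<close> says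
  (\<open>normal_v_vanishes_on_axis\<close>), since \<open>n\<^sub>v\<close> is in any case orthogonal to \<open>n\<close> and to \<open>g\<^sub>u\<close>.
  Hence \<open>C\<^sub>v = \<rho>\<^sub>v n\<close>, while \<open>\<langle>C\<^sub>u, h\<rangle> = - \<rho> \<kappa>\<^sub>t \<noteq> 0\<close> with \<open>h\<close> orthogonal to \<open>n\<close>. So the origin
  is a singular point of \<open>C\<close> exactly when \<open>\<rho>\<^sub>v = 0\<close>, that is, when the principal curvature
  satisfies \<open>\<kappa>\<^sub>v = 0\<close> (\<open>focal_surface_singular_iff\<close>).

  To compute \<open>\<kappa>\<^sub>v\<close>, differentiate the quadratic equation
  \<open>(E G - F\<^sup>2) \<kappa>\<^sup>2 - (E N\<^sub>1 - 2 F M + G L) \<kappa> + (L N\<^sub>1 - M\<^sup>2) = 0\<close> in \<open>v\<close>. At the origin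
  \<open>E = G = 1\<close>, \<open>F = 0\<close> and \<open>E\<^sub>v = L\<^sub>v = 0\<close>, and expanding \<open>n\<^sub>u\<close> in the frame \<open>g\<^sub>u, h, n\<close> gives
  \<open>M\<^sub>v = L F\<^sub>v + M G\<^sub>v / 2\<close>. All terms then combine to
  \<open>(2 \<kappa> - (L + N\<^sub>1)) \<kappa>\<^sub>v = (r\<^sub>c / 24) (\<kappa> - L)\<close> (\<open>principal_curvature_derivative\<close>). Since
  \<open>(\<kappa> - L) (\<kappa> - N\<^sub>1) = M\<^sup>2 > 0\<close>, both factors next to \<open>\<kappa>\<^sub>v\<close> and \<open>r\<^sub>c\<close> are nonzero, so \<open>\<kappa>\<^sub>v\<close> and \<open>r\<^sub>c\<close>
  vanish together, for either of the two principal curvatures.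

  Three analytic facts support the computation: smooth maps are closed under composition, so that
  \<open>g\<close> and \<open>n\<close> are smooth; second derivatives are symmetric, so that \<open>g\<^sub>u\<^sub>v\<close> and \<open>n\<^sub>u\<^sub>v\<close> vanish at the
  origin; and \<open>h\<close> and \<open>\<nu>\<^sub>1\<close>, which are quotients by \<open>v\<close>, are differentiable at the origin
  (\<open>div_v_has_derivative\<close>), so that the curvatures are.
\<close>

section \<open>Calculus of smooth maps\<close>

lemma Ck_on_cong:
  assumes "open U" "\<And>x. x \<in> U \<Longrightarrow> f x = g x" "Ck_on k U f"
  shows "Ck_on k U g"
  using assms(2,3)
proof (induction k arbitrary: f g)
  case 0
  then show ?case by (metis Ck_on.simps(1) continuous_on_cong)
next
  case (Suc k)
  have df: "f differentiable at x" if "x \<in> U" for x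
    using Suc.prems(2) that by simp
  have fr: "frechet_derivative f (at x) = frechet_derivative g (at x)" if "x \<in> U" for x
    using frechet_derivative_transform_within_open[OF df[OF that] assms(1) that] Suc.prems(1) by blast
  have dg: "g differentiable at x" if "x \<in> U" for x
    using df[OF that] has_derivative_transform_within_open[OF _ assms(1) that] Suc.prems(1)
    unfolding differentiable_def by blast
  have "Ck_on k U (\<lambda>x. frechet_derivative g (at x) w)" for w
    using Suc.IH[of "\<lambda>x. frechet_derivative f (at x) w"] Suc.prems fr by auto
  then show ?case using dg by simp
qed

lemma Ck_on_SucD:
  "Ck_on (Suc k) U f \<Longrightarrow> Ck_on k U f"
proof (induction k arbitrary: f)
  case 0
  then show ?case
    by (auto intro!: continuous_at_imp_continuous_on differentiable_imp_continuous_within)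
next
  case (Suc k)
  then show ?case by (auto simp del: Ck_on.simps(2) simp: Ck_on.simps(2)[of "Suc k"] Ck_on.simps(2)[of k U f])
qed

lemma Ck_on_const: "Ck_on k U (\<lambda>x. c)"
  by (induction k arbitrary: c) auto

lemma Ck_on_add:
  assumes "open U" "Ck_on k U f" "Ck_on k U g"
  shows "Ck_on k U (\<lambda>x. f x + g x)"
  using assms(2,3)
proof (induction k arbitrary: f g)
  case 0
  then show ?case by (simp add: continuous_on_add)
next
  case (Suc k)
  have *: "frechet_derivative (\<lambda>x. f x + g x) (at x) w
      = frechet_derivative f (at x) w + frechet_derivative g (at x) w" if "x \<in> U" for x w
  proof -
    have "((\<lambda>x. f x + g x) has_derivative
      (\<lambda>w. frechet_derivative f (at x) w + frechet_derivative g (at x) w)) (at x)"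
      using Suc.prems that by (intro has_derivative_add) (auto simp: frechet_derivative_works[symmetric])
    then show ?thesis by (metis frechet_derivative_at)
  qed
  have "Ck_on k U (\<lambda>x. frechet_derivative (\<lambda>x. f x + g x) (at x) w)" for w
    using Ck_on_cong[OF assms(1) *[symmetric] Suc.IH] Suc.prems by simp
  then show ?case using Suc.prems by simp
qed

lemma Ck_on_sum:
  assumes "open U" "\<And>i. i \<in> I \<Longrightarrow> Ck_on k U (f i)"
  shows "Ck_on k U (\<lambda>x. \<Sum>i\<in>I. f i x)"
  using assms(2)
  by (induction I rule: infinite_finite_induct) (auto intro: Ck_on_const Ck_on_add[OF assms(1)])

lemma (in bounded_bilinear) Ck_on_prod:
  assumes "open U" "Ck_on k U f" "Ck_on k U g"
  shows "Ck_on k U (\<lambda>x. prod (f x) (g x))"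
  using assms(2,3)
proof (induction k arbitrary: f g)
  case 0
  then show ?case by (simp add: continuous_on)
next
  case (Suc k)
  have d: "((\<lambda>x. prod (f x) (g x)) has_derivative
      (\<lambda>w. prod (f x) (frechet_derivative g (at x) w) + prod (frechet_derivative f (at x) w) (g x))) (at x)"
    if "x \<in> U" for x
    using FDERIV[of f _ x UNIV g] Suc.prems that by (simp add: frechet_derivative_works)
  have *: "frechet_derivative (\<lambda>x. prod (f x) (g x)) (at x) w
      = prod (f x) (frechet_derivative g (at x) w) + prod (frechet_derivative f (at x) w) (g x)"
    if "x \<in> U" for x w
    using d[OF that] by (metis frechet_derivative_at)
  have "Ck_on k U (\<lambda>x. frechet_derivative (\<lambda>x. prod (f x) (g x)) (at x) w)" for w
  proof (rule Ck_on_cong[OF assms(1) *[symmetric]], assumption, rule Ck_on_add[OF assms(1)])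
    show "Ck_on k U (\<lambda>x. prod (f x) (frechet_derivative g (at x) w))"
      using Suc.IH[OF Ck_on_SucD[OF Suc.prems(1)]] Suc.prems(2) by simp
    show "Ck_on k U (\<lambda>x. prod (frechet_derivative f (at x) w) (g x))"
      using Suc.IH[OF _ Ck_on_SucD[OF Suc.prems(2)]] Suc.prems(1) by simp
  qed
  then show ?case using d by (auto simp: differentiable_def)
qed

text \<open>The derivative of \<open>f\<close> occurs in the chain rule in a direction that varies with the point, while \<open>Ck_on\<close> speaks of
  fixed directions; expanding the varying direction in the basis leads to sums of products, to which the induction
  hypothesis applies.\<close>

lemma Ck_on_compose:
  fixes \<phi> :: "'a::real_normed_vector \<Rightarrow> 'b::euclidean_space" and f :: "'b \<Rightarrow> 'c::real_normed_vector"
  assumes "open U" "\<phi> ` U \<subseteq> V" "Ck_on k U \<phi>" "Ck_on k V f"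
  shows "Ck_on k U (f \<circ> \<phi>)"
  using assms(3,4)
proof (induction k arbitrary: f)
  case 0
  then have "continuous_on U \<phi>" "continuous_on V f" by simp_all
  from continuous_on_compose2[OF this(2,1) assms(2)] show ?case by (simp add: o_def)
next
  case (Suc k)
  have d\<phi>: "\<phi> differentiable at x" if "x \<in> U" for x
    using Suc.prems(1) that by simp
  have df: "f differentiable at (\<phi> x)" if "x \<in> U" for x
    using Suc.prems(2) that assms(2) by auto
  have d: "((f \<circ> \<phi>) has_derivative
      frechet_derivative f (at (\<phi> x)) \<circ> frechet_derivative \<phi> (at x)) (at x)" if "x \<in> U" for x
    using diff_chain_at[OF d\<phi>[OF that, unfolded frechet_derivative_works] df[OF that, unfolded frechet_derivative_works]] .
  have *: "frechet_derivative (f \<circ> \<phi>) (at x) w =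
      (\<Sum>b\<in>Basis. (frechet_derivative \<phi> (at x) w \<bullet> b) *\<^sub>R ((\<lambda>y. frechet_derivative f (at y) b) \<circ> \<phi>) x)"
    if "x \<in> U" for x w
  proof -
    have "linear (frechet_derivative f (at (\<phi> x)))"
      using df[OF that] by (rule linear_frechet_derivative)
    then have "frechet_derivative f (at (\<phi> x)) (\<Sum>b\<in>Basis. (y \<bullet> b) *\<^sub>R b)
        = (\<Sum>b\<in>Basis. (y \<bullet> b) *\<^sub>R frechet_derivative f (at (\<phi> x)) b)" for y
      by (simp only: linear_sum linear_scale)
    then have expand: "frechet_derivative f (at (\<phi> x)) y
        = (\<Sum>b\<in>Basis. (y \<bullet> b) *\<^sub>R frechet_derivative f (at (\<phi> x)) b)" for y
      unfolding euclidean_representation .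
    have "frechet_derivative (f \<circ> \<phi>) (at x) w
        = frechet_derivative f (at (\<phi> x)) (frechet_derivative \<phi> (at x) w)"
      using fun_cong[OF frechet_derivative_at[OF d[OF that]], of w] by simp
    from trans[OF this expand] show ?thesis unfolding comp_apply .
  qed
  have "Ck_on k U (\<lambda>x. frechet_derivative (f \<circ> \<phi>) (at x) w)" for w
  proof (rule Ck_on_cong[OF assms(1) *[symmetric]], assumption,
      intro Ck_on_sum[OF assms(1)] bounded_bilinear.Ck_on_prod[OF bounded_bilinear_scaleR assms(1)])
    fix b :: 'b
    have "Ck_on k U (\<lambda>x. frechet_derivative \<phi> (at x) w)" using Suc.prems(1) by simp
    from bounded_bilinear.Ck_on_prod[OF bounded_bilinear_inner assms(1) this Ck_on_const]
    show "Ck_on k U (\<lambda>x. frechet_derivative \<phi> (at x) w \<bullet> b)" .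
    have "Ck_on k V (\<lambda>y. frechet_derivative f (at y) b)" using Suc.prems(2) by simp
    then show "Ck_on k U ((\<lambda>y. frechet_derivative f (at y) b) \<circ> \<phi>)"
      using Suc.IH Ck_on_SucD[OF Suc.prems(1)] by blast
  qed
  then show ?case unfolding Ck_on.simps differentiable_def using d by blast
qed

lemma smooth_on_compose:
  fixes \<phi> :: "'a::real_normed_vector \<Rightarrow> 'b::euclidean_space"
  assumes "open U" "\<phi> ` U \<subseteq> V" "smooth_on U \<phi>" "smooth_on V f"
  shows "smooth_on U (f \<circ> \<phi>)"
  using assms Ck_on_compose unfolding smooth_on_def by blast

lemma smooth_on_differentiable: "smooth_on U f \<Longrightarrow> x \<in> U \<Longrightarrow> f differentiable at x"
  unfolding smooth_on_def by (metis Ck_on.simps(2))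

lemma smooth_on_pd: "smooth_on U f \<Longrightarrow> smooth_on U (pd i f)"
  unfolding smooth_on_def pd_def by (metis Ck_on.simps(2))

section \<open>Symmetry of second derivatives\<close>

text \<open>The increment of \<open>s \<mapsto> f (p + t x + s t y) - f (p + s t y)\<close> over \<open>[0, 1]\<close> is the
  second difference of \<open>f\<close>. By the mean value inequality it is controlled by the derivative in \<open>s\<close>,
  which is \<open>t\<close> times a difference of values of the directional derivative \<open>Y\<close> of \<open>f\<close> along \<open>y\<close>; the
  latter is \<open>t D x + o(t)\<close> because \<open>Y\<close> is differentiable at the single point \<open>p\<close>.\<close>

lemma second_difference_limit:
  fixes f :: "'a::real_normed_vector \<Rightarrow> 'b::real_normed_vector"
  assumes "\<forall>\<^sub>F q in nhds p. f differentiable at q"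
    and D: "((\<lambda>q. frechet_derivative f (at q) y) has_derivative D) (at p)"
  shows "((\<lambda>t. (f (p + t *\<^sub>R x + t *\<^sub>R y) - f (p + t *\<^sub>R x) - f (p + t *\<^sub>R y) + f p) /\<^sub>R t\<^sup>2)
          \<longlongrightarrow> D x) (at 0)"
proof -
  define Y where "Y q = frechet_derivative f (at q) y" for q
  interpret D: bounded_linear D using D by (rule has_derivative_bounded_linear)
  \<comment> \<open>the error is at most twice \<open>norm x + norm y\<close> times \<open>e\<close>; adding \<open>1\<close> makes \<open>K\<close> positive\<close>
  define K where "K = 2 * (norm x + norm y) + 1"
  have K: "K > 0" by (simp add: K_def add_nonneg_pos)
  show ?thesis
  proof (rule LIM_I)
    fix r :: real assume r: "r > 0"
    define e where "e = r / (2 * K)"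
    have e: "e > 0" using r K by (simp add: e_def)
    obtain d1 where d1: "d1 > 0" "\<And>q. norm (q - p) < d1 \<Longrightarrow> norm (Y q - Y p - D (q - p)) \<le> e * norm (q - p)"
      using D e unfolding has_derivative_at_alt Y_def by meson
    obtain d2 where d2: "d2 > 0" "\<And>q. dist q p < d2 \<Longrightarrow> f differentiable at q"
      using assms(1) unfolding eventually_nhds_metric by blast
    define d where "d = min d1 d2"
    have d: "d > 0" using d1 d2 by (simp add: d_def)
    have dfar: "f differentiable at q" if "norm (q - p) < d" for q
      using d2 that by (simp add: d_def dist_norm)
    have bnd: "norm (Y q - Y p - D (q - p)) \<le> e * norm (q - p)" if "norm (q - p) < d" for q
      using d1 that by (simp add: d_def)
    show "\<exists>s>0. \<forall>t. t \<noteq> 0 \<and> norm (t - 0) < s \<longrightarrow>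
       norm ((f (p + t *\<^sub>R x + t *\<^sub>R y) - f (p + t *\<^sub>R x) - f (p + t *\<^sub>R y) + f p) /\<^sub>R t\<^sup>2 - D x) < r"
    proof (intro exI[of _ "d / K"] conjI allI impI)
      show "d / K > 0" using d K by simp
      fix t :: real assume t: "t \<noteq> 0 \<and> norm (t - 0) < d / K"
      then have tK: "\<bar>t\<bar> * K < d" using K by (simp add: field_simps)
      define a where "a s = p + t *\<^sub>R x + (s * t) *\<^sub>R y" for s
      define b where "b s = p + (s * t) *\<^sub>R y" for s
      define P where "P s = f (a s) - f (b s) - (s * t\<^sup>2) *\<^sub>R D x" for s
      have na: "norm (a s - p) \<le> \<bar>t\<bar> * (norm x + norm y)"
        and nb: "norm (b s - p) \<le> \<bar>t\<bar> * (norm x + norm y)" if "0 \<le> s" "s \<le> 1" for s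
      proof -
        have *: "\<bar>s * t\<bar> * norm y \<le> \<bar>t\<bar> * norm y"
          using that by (intro mult_right_mono) (auto simp: abs_mult mult_left_le_one_le)
        have "norm (a s - p) \<le> \<bar>t\<bar> * norm x + \<bar>s * t\<bar> * norm y"
          unfolding a_def by (metis add.assoc add_diff_cancel_left' norm_scaleR norm_triangle_ineq)
        then show "norm (a s - p) \<le> \<bar>t\<bar> * (norm x + norm y)" using * by (simp add: algebra_simps)
        have "norm (b s - p) = \<bar>s * t\<bar> * norm y" by (simp add: b_def)
        then show "norm (b s - p) \<le> \<bar>t\<bar> * (norm x + norm y)" using * by (simp add: algebra_simps add_increasing)
      qed
      have half: "\<bar>t\<bar> * (norm x + norm y) < d"
      proof -
        have "\<bar>t\<bar> * (norm x + norm y) \<le> \<bar>t\<bar> * K" by (intro mult_left_mono) (auto simp: K_def)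
        then show ?thesis using tK by linarith
      qed
      have deriv: "(P has_derivative (\<lambda>h. (h * t) *\<^sub>R (Y (a s) - Y (b s) - D (t *\<^sub>R x)))) (at s within {0..1})"
        if s: "s \<in> {0..1}" for s
      proof -
        have fa: "(f has_derivative frechet_derivative f (at (a s))) (at (a s))"
          and fb: "(f has_derivative frechet_derivative f (at (b s))) (at (b s))"
          using dfar[of "a s"] dfar[of "b s"] na[of s] nb[of s] half s
          by (auto simp: frechet_derivative_works[symmetric])
        have "(a has_derivative (\<lambda>h. (h * t) *\<^sub>R y)) (at s within {0..1})"
          unfolding a_def by (auto intro!: derivative_eq_intros)
        note ca = has_derivative_compose[OF this fa]
        have "(b has_derivative (\<lambda>h. (h * t) *\<^sub>R y)) (at s within {0..1})"
          unfolding b_def by (auto intro!: derivative_eq_intros)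
        note cb = has_derivative_compose[OF this fb]
        have la: "frechet_derivative f (at (a s)) ((h * t) *\<^sub>R y) = (h * t) *\<^sub>R Y (a s)"
          and lb: "frechet_derivative f (at (b s)) ((h * t) *\<^sub>R y) = (h * t) *\<^sub>R Y (b s)" for h
          unfolding Y_def using fa fb
          by (meson has_derivative_bounded_linear linear_simps(5))+
        show ?thesis unfolding P_def
          by (rule has_derivative_eq_rhs, rule has_derivative_diff, rule has_derivative_diff, rule ca, rule cb,
              rule derivative_intros, rule derivative_intros, rule derivative_intros)
            (auto simp: la lb fun_eq_iff D.scaleR algebra_simps power2_eq_square)
      qed
      have onb: "onorm (\<lambda>h. (h * t) *\<^sub>R (Y (a s) - Y (b s) - D (t *\<^sub>R x))) \<le> t\<^sup>2 * (e * K)"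
        if s: "s \<in> {0..1}" for s
      proof (rule onorm_le)
        fix h :: real
        have eq: "Y (a s) - Y (b s) - D (t *\<^sub>R x)
            = (Y (a s) - Y p - D (a s - p)) - (Y (b s) - Y p - D (b s - p))"
          by (simp add: a_def b_def D.add D.diff D.scaleR algebra_simps)
        have "norm (Y (a s) - Y p - D (a s - p)) \<le> e * (\<bar>t\<bar> * (norm x + norm y))"
          using bnd[of "a s"] na[of s] half s e by (auto intro: order_trans mult_left_mono)
        moreover have "norm (Y (b s) - Y p - D (b s - p)) \<le> e * (\<bar>t\<bar> * (norm x + norm y))"
          using bnd[of "b s"] nb[of s] half s e by (auto intro: order_trans mult_left_mono)
        ultimately have "norm (Y (a s) - Y (b s) - D (t *\<^sub>R x)) \<le> 2 * (e * (\<bar>t\<bar> * (norm x + norm y)))"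
          unfolding eq by (smt (verit) norm_triangle_ineq4)
        also have "\<dots> \<le> \<bar>t\<bar> * (e * K)" using e by (simp add: K_def algebra_simps)
        finally have "norm (Y (a s) - Y (b s) - D (t *\<^sub>R x)) \<le> \<bar>t\<bar> * (e * K)" .
        then have "\<bar>h * t\<bar> * norm (Y (a s) - Y (b s) - D (t *\<^sub>R x)) \<le> \<bar>h * t\<bar> * (\<bar>t\<bar> * (e * K))"
          by (intro mult_left_mono) auto
        also have "\<dots> = t\<^sup>2 * (e * K) * norm h" by (simp add: abs_mult power2_eq_square)
        finally show "norm ((h * t) *\<^sub>R (Y (a s) - Y (b s) - D (t *\<^sub>R x))) \<le> t\<^sup>2 * (e * K) * norm h"
          by simp
      qed
      have "norm (P 1 - P 0) \<le> t\<^sup>2 * (e * K) * norm ((1::real) - 0)"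
        by (rule differentiable_bound[OF convex_real_interval(5) deriv onb]) auto
      then have "norm (P 1 - P 0) \<le> t\<^sup>2 * (e * K)" by simp
      also have "\<dots> < t\<^sup>2 * r" using t r K by (simp add: e_def)
      finally have lt: "norm (P 1 - P 0) < t\<^sup>2 * r" .
      have "(f (p + t *\<^sub>R x + t *\<^sub>R y) - f (p + t *\<^sub>R x) - f (p + t *\<^sub>R y) + f p) /\<^sub>R t\<^sup>2 - D x
          = (P 1 - P 0) /\<^sub>R t\<^sup>2"
        using t by (simp add: P_def a_def b_def algebra_simps)
      then show "norm ((f (p + t *\<^sub>R x + t *\<^sub>R y) - f (p + t *\<^sub>R x) - f (p + t *\<^sub>R y) + f p) /\<^sub>R t\<^sup>2 - D x) < r"
        using lt t by (simp only: norm_scaleR norm_inverse) (simp add: field_simps)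
    qed
  qed
qed

text \<open>The second difference is symmetric in the two directions, hence so is its limit.\<close>

lemma second_derivative_symmetric:
  fixes f :: "'a::real_normed_vector \<Rightarrow> 'b::real_normed_vector"
  assumes "\<forall>\<^sub>F q in nhds p. f differentiable at q"
    and x: "(\<lambda>q. frechet_derivative f (at q) x) differentiable at p"
    and y: "(\<lambda>q. frechet_derivative f (at q) y) differentiable at p"
  shows "frechet_derivative (\<lambda>q. frechet_derivative f (at q) y) (at p) x
       = frechet_derivative (\<lambda>q. frechet_derivative f (at q) x) (at p) y"
proof -
  define S where "S x y =
    (\<lambda>t. (f (p + t *\<^sub>R x + t *\<^sub>R y) - f (p + t *\<^sub>R x) - f (p + t *\<^sub>R y) + f p) /\<^sub>R t\<^sup>2)" for x y
  have sym: "S x y = S y x"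
    unfolding S_def by (rule ext) (simp add: algebra_simps)
  have 1: "(S x y \<longlongrightarrow> frechet_derivative (\<lambda>q. frechet_derivative f (at q) y) (at p) x) (at 0)"
    unfolding S_def by (rule second_difference_limit[OF assms(1) y[unfolded frechet_derivative_works]])
  have 2: "(S y x \<longlongrightarrow> frechet_derivative (\<lambda>q. frechet_derivative f (at q) x) (at p) y) (at 0)"
    unfolding S_def by (rule second_difference_limit[OF assms(1) x[unfolded frechet_derivative_works]])
  show ?thesis by (rule LIM_unique[OF 1 2[folded sym]])
qed

lemma pd_commute:
  assumes "open U" "smooth_on U f" "p \<in> U"
  shows "pd i (pd j f) p = pd j (pd i f) p"
proof -
  have ev: "\<forall>\<^sub>F q in nhds p. f differentiable at q"
    using assms(1,3) smooth_on_differentiable[OF assms(2)] unfolding eventually_nhds by blast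
  have "(\<lambda>q. frechet_derivative f (at q) (axis k 1)) differentiable at p" for k
    using smooth_on_differentiable[OF smooth_on_pd[OF assms(2), of k] assms(3)] unfolding pd_def .
  from second_derivative_symmetric[OF ev this this] show ?thesis unfolding pd_def .
qed

section \<open>Partial derivatives in the plane\<close>

lemma pd_eqI: "(f has_derivative D) (at p) \<Longrightarrow> pd i f p = D (axis i 1)"
  by (simp add: pd_def frechet_derivative_at[symmetric])

lemma frechet_derivative_pd:
  fixes f :: "real^2 \<Rightarrow> 'a::real_normed_vector"
  assumes "f differentiable at p"
  shows "frechet_derivative f (at p) w = (w $ 1) *\<^sub>R pd 1 f p + (w $ 2) *\<^sub>R pd 2 f p"
proof -
  interpret linear "frechet_derivative f (at p)" by (rule linear_frechet_derivative[OF assms])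
  have "w = (w $ 1) *\<^sub>R axis 1 1 + (w $ 2) *\<^sub>R axis 2 1"
    by (simp add: vec_eq_iff forall_2 axis_def)
  then show ?thesis unfolding pd_def by (metis add scale)
qed

lemma pd_inner:
  assumes "a differentiable at p" "b differentiable at p"
  shows "pd i (\<lambda>q. a q \<bullet> b q) p = pd i a p \<bullet> b p + a p \<bullet> pd i b p"
proof -
  have "((\<lambda>q. a q \<bullet> b q) has_derivative
     (\<lambda>w. a p \<bullet> frechet_derivative b (at p) w + frechet_derivative a (at p) w \<bullet> b p)) (at p)"
    using assms by (intro has_derivative_inner) (auto simp: frechet_derivative_works)
  from pd_eqI[OF this] show ?thesis by (simp add: pd_def)
qed

lemma pd_uminus: "f differentiable at p \<Longrightarrow> pd i (\<lambda>q. - f q) p = - pd i f p"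
  by (rule pd_eqI[OF has_derivative_minus, of f "frechet_derivative f (at p)", folded pd_def])
    (simp add: frechet_derivative_works)

lemma pd_has_vector_derivative:
  assumes "f differentiable at p"
  shows "((\<lambda>t. f (p + t *\<^sub>R axis i 1)) has_vector_derivative pd i f p) (at 0)"
proof -
  have f: "(f has_derivative frechet_derivative f (at p)) (at (p + 0 *\<^sub>R axis i 1))"
    using assms by (simp add: frechet_derivative_works)
  have "((\<lambda>t. p + t *\<^sub>R axis i 1) has_derivative (\<lambda>t. t *\<^sub>R axis i 1)) (at (0::real))"
    by (auto intro!: derivative_eq_intros)
  from has_derivative_compose[OF this f]
  show ?thesis
    by (simp add: has_vector_derivative_def pd_def linear_scale[OF linear_frechet_derivative[OF assms]])
qed

lemma pd_along_line_const:
  assumes "f differentiable at p" "\<forall>\<^sub>F t in nhds 0. f (p + t *\<^sub>R axis i 1) = c"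
  shows "pd i f p = 0"
proof -
  have "((\<lambda>t. c) has_vector_derivative pd i f p) (at 0)"
    by (rule has_vector_derivative_transform_within_open[OF pd_has_vector_derivative[OF assms(1)], of "interior {t. f (p + t *\<^sub>R axis i 1) = c}"])
      (use assms(2) interior_subset in \<open>auto simp: eventually_nhds interior_def\<close>)
  then show ?thesis by (metis has_vector_derivative_const vector_derivative_at)
qed

text \<open>The form in which tangential derivatives of quantities that are constant along the \<open>u\<close>-axis are
  discarded.\<close>

lemma pd_1_axis_const:
  assumes "f differentiable at p" "p $ 2 = 0" "\<forall>\<^sub>F q in nhds p. q $ 2 = 0 \<longrightarrow> f q = c"
  shows "pd 1 f p = 0"
proof (rule pd_along_line_const[OF assms(1)])
  have "((\<lambda>t. p + t *\<^sub>R axis 1 1) \<longlongrightarrow> p + 0 *\<^sub>R axis 1 1) (nhds (0::real))"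
    by (intro tendsto_add tendsto_scaleR tendsto_const) (simp add: filterlim_ident)
  then have "filterlim (\<lambda>t. p + t *\<^sub>R axis 1 1) (nhds p) (nhds (0::real))" by simp
  from eventually_compose_filterlim[OF assms(3) this]
  show "\<forall>\<^sub>F t in nhds 0. f (p + t *\<^sub>R axis 1 1) = c"
    using assms(2) by (simp add: axis_def)
qed

lemma pd_const_on_open:
  assumes "open W" "q \<in> W" "\<And>x. x \<in> W \<Longrightarrow> F x = c"
  shows "pd i F q = 0"
proof -
  have "(F has_derivative (\<lambda>w. 0)) (at q)"
    by (rule has_derivative_transform_within_open[OF has_derivative_const assms(1,2)]) (simp add: assms(3))
  from pd_eqI[OF this] show ?thesis .
qed

lemma pd_unit:
  fixes n :: "real^2 \<Rightarrow> 'a::real_inner"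
  assumes "open W" "q \<in> W" "n differentiable at q" "\<And>x. x \<in> W \<Longrightarrow> norm (n x) = 1"
  shows "pd i n q \<bullet> n q = 0"
proof -
  have "pd i (\<lambda>x. n x \<bullet> n x) q = 0"
    by (rule pd_const_on_open[OF assms(1,2), of _ 1]) (simp add: dot_square_norm assms(4))
  then show ?thesis by (simp add: pd_inner assms(3) inner_commute)
qed

section \<open>Division by the second coordinate\<close>

text \<open>Instead of writing \<open>G / v\<close> as the integral of \<open>G\<^sub>v\<close> over the segment from the axis, the proof
  estimates the remainder \<open>R = G - v G\<^sub>v(0) - u v G\<^sub>v\<^sub>u(0) - v\<^sup>2 G\<^sub>v\<^sub>v(0) / 2\<close>. It vanishes on the axis and
  its \<open>v\<close>-derivative is the error of the linear approximation of \<open>G\<^sub>v\<close> at the origin; so the mean value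
  inequality along the segment bounds \<open>R / v\<close>, which is the error of the asserted linear
  approximation of \<open>G / v\<close>. The factor \<open>1/2\<close> comes from the term \<open>v\<^sup>2 / 2\<close>.\<close>

lemma div_v_has_derivative:
  fixes G :: "real^2 \<Rightarrow> real^3"
  assumes "\<forall>\<^sub>F q in nhds 0. G differentiable at q"
    and "\<forall>\<^sub>F q in nhds 0. q $ 2 = 0 \<longrightarrow> G q = 0"
    and D: "(pd 2 G has_derivative D) (at 0)"
  shows "(div_v G has_derivative (\<lambda>w. (w $ 1) *\<^sub>R D (axis 1 1) + (w $ 2 / 2) *\<^sub>R D (axis 2 1))) (at 0)"
proof -
  interpret D: bounded_linear D using D by (rule has_derivative_bounded_linear)
  have Dw: "D w = (w $ 1) *\<^sub>R D (axis 1 1) + (w $ 2) *\<^sub>R D (axis 2 1)" for w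
  proof -
    have "w = (w $ 1) *\<^sub>R axis 1 1 + (w $ 2) *\<^sub>R axis 2 1"
      by (simp add: vec_eq_iff forall_2 axis_def)
    then show ?thesis by (metis D.add D.scaleR)
  qed
  define D' where "D' w = (w $ 1) *\<^sub>R D (axis 1 1) + (w $ 2 / 2) *\<^sub>R D (axis 2 1)" for w :: "real^2"
  have "bounded_linear D'" unfolding D'_def linear_conv_bounded_linear[symmetric]
    by (rule linearI) (auto simp: algebra_simps add_divide_distrib)
  moreover have "\<exists>d>0. \<forall>q. norm (q - 0) < d \<longrightarrow> norm (div_v G q - div_v G 0 - D' (q - 0)) \<le> e * norm (q - 0)"
    if e: "e > 0" for e
  proof -
    obtain d1 where d1: "d1 > 0" "\<And>q. norm q < d1 \<Longrightarrow> norm (pd 2 G q - pd 2 G 0 - D q) \<le> e * norm q"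
      using D e unfolding has_derivative_at_alt by (metis diff_zero)
    have "\<forall>\<^sub>F q in nhds 0. G differentiable at q \<and> (q $ 2 = 0 \<longrightarrow> G q = 0)"
      using assms(1,2) by eventually_elim auto
    then obtain d2 where d2: "d2 > 0" "\<And>q. norm q < d2 \<Longrightarrow> G differentiable at q \<and> (q $ 2 = 0 \<longrightarrow> G q = 0)"
      unfolding eventually_nhds_metric by auto
    show ?thesis
    proof (intro exI[of _ "min d1 d2"] conjI allI impI)
      show "min d1 d2 > 0" using d1 d2 by simp
      fix q :: "real^2" assume "norm (q - 0) < min d1 d2"
      then have q1: "norm q < d1" and q2: "norm q < d2" by auto
      have "norm (div_v G q - div_v G 0 - D' q) \<le> e * norm q"
      proof (cases "q $ 2 = 0")
        case True
        then show ?thesis using d1(2)[OF q1] by (simp add: div_v_def D'_def Dw[of q])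
      next
        case False
        define v where "v = q $ 2"
        define c where "c s = (q $ 1) *\<^sub>R axis 1 1 + (s * v) *\<^sub>R (axis 2 1 :: real^2)" for s
        have cc: "c s $ 1 = q $ 1" "c s $ 2 = s * v" for s by (auto simp: c_def axis_def)
        have nc: "norm (c s) \<le> norm q" if "s \<in> {0..1}" for s
        proof (rule norm_le_componentwise_cart)
          fix i :: 2
          have "\<bar>s * v\<bar> \<le> \<bar>v\<bar>" using that by (auto simp: abs_mult mult_left_le_one_le)
          then show "norm (c s $ i) \<le> norm (q $ i)"
            using exhaust_2[of i] by (auto simp: cc v_def)
        qed
        \<comment> \<open>the remainder at height \<open>s v\<close>, with \<open>s\<close> running from the axis to the point \<open>q\<close>\<close>
        define R where "R s = G (c s) - (s * v) *\<^sub>R pd 2 G 0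
            - (s * v * q $ 1) *\<^sub>R D (axis 1 1) - ((s * v)\<^sup>2 / 2) *\<^sub>R D (axis 2 1)" for s
        have deriv: "(R has_derivative (\<lambda>h. (h * v) *\<^sub>R (pd 2 G (c s) - pd 2 G 0 - D (c s)))) (at s within {0..1})"
          if s: "s \<in> {0..1}" for s
        proof -
          have df: "G differentiable at (c s)" using d2(2)[of "c s"] nc[OF s] q2 by linarith
          have c: "(c has_derivative (\<lambda>h. (h * v) *\<^sub>R axis 2 1)) (at s within {0..1})"
            unfolding c_def by (auto intro!: derivative_eq_intros)
          have "((\<lambda>s. G (c s)) has_derivative (\<lambda>h. (h * v) *\<^sub>R pd 2 G (c s))) (at s within {0..1})"
            by (rule has_derivative_eq_rhs[OF has_derivative_compose[OF c df[unfolded frechet_derivative_works]]])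
              (simp add: pd_def linear_scale[OF linear_frechet_derivative[OF df]])
          then show ?thesis unfolding R_def
            by (rule has_derivative_eq_rhs[OF has_derivative_diff[OF has_derivative_diff[OF has_derivative_diff]]])
              (auto intro!: derivative_eq_intros simp: fun_eq_iff Dw[of "c s"] cc algebra_simps power2_eq_square)
        qed
        have onb: "onorm (\<lambda>h. (h * v) *\<^sub>R (pd 2 G (c s) - pd 2 G 0 - D (c s))) \<le> \<bar>v\<bar> * (e * norm q)"
          if s: "s \<in> {0..1}" for s
        proof (rule onorm_le)
          fix h :: real
          have "norm (pd 2 G (c s) - pd 2 G 0 - D (c s)) \<le> e * norm (c s)"
            using d1(2)[of "c s"] nc[OF s] q1 by linarith
          also have "\<dots> \<le> e * norm q" using nc[OF s] e by (intro mult_left_mono) auto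
          finally have "\<bar>h * v\<bar> * norm (pd 2 G (c s) - pd 2 G 0 - D (c s)) \<le> \<bar>h * v\<bar> * (e * norm q)"
            by (intro mult_left_mono) auto
          then show "norm ((h * v) *\<^sub>R (pd 2 G (c s) - pd 2 G 0 - D (c s))) \<le> \<bar>v\<bar> * (e * norm q) * norm h"
            by (simp add: abs_mult mult_ac)
        qed
        have "norm (R 1 - R 0) \<le> \<bar>v\<bar> * (e * norm q) * norm ((1::real) - 0)"
          by (rule differentiable_bound[OF convex_real_interval(5) deriv onb]) auto
        moreover have "G (c 0) = 0" using d2(2)[of "c 0"] nc[of 0] q2 by (simp add: cc)
        moreover have "c 1 = q" by (simp add: vec_eq_iff forall_2 cc v_def)
        ultimately have le: "norm (R 1) \<le> \<bar>v\<bar> * (e * norm q)" by (simp add: R_def)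
        have "div_v G q - div_v G 0 - D' q = R 1 /\<^sub>R v"
          using False \<open>c 1 = q\<close>
          by (simp add: div_v_def D'_def R_def v_def algebra_simps power2_eq_square)
        then show ?thesis using le False by (simp add: v_def field_simps)
      qed
      then show "norm (div_v G q - div_v G 0 - D' (q - 0)) \<le> e * norm (q - 0)" by simp
    qed
  qed
  ultimately show ?thesis unfolding has_derivative_at_alt D'_def[symmetric] by blast
qed

section \<open>Linear algebra in space\<close>

lemma sing_set_iff:
  fixes f :: "real^2 \<Rightarrow> real^3"
  assumes "f differentiable at q"
  shows "q \<in> sing_set f \<longleftrightarrow> (\<exists>w. w \<noteq> 0 \<and> frechet_derivative f (at q) w = 0)"
proof -
  have lin: "linear (frechet_derivative f (at q))" by (rule linear_frechet_derivative[OF assms])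
  have "frechet_derivative f (at q) = (*v) (jacobian f (at q))"
    using frechet_derivative_at[OF jacobian_works[THEN iffD1, OF assms]] by simp
  then have "q \<in> sing_set f \<longleftrightarrow> \<not> inj (frechet_derivative f (at q))"
    unfolding sing_set_def using less_rank_noninjective[of "jacobian f (at q)"] by simp
  then show ?thesis using linear_injective_0[OF lin] by blast
qed

text \<open>The square of the determinant is the Gram determinant of the rows, which is diagonal here.\<close>

lemma orthogonal_det_square:
  fixes a b c :: "real^3"
  assumes "a \<bullet> b = 0" "a \<bullet> c = 0" "b \<bullet> c = 0"
  shows "(det (vector [a, b, c] :: real^3^3))\<^sup>2 = (a \<bullet> a) * (b \<bullet> b) * (c \<bullet> c)"
proof -
  let ?A = "vector [a, b, c] :: real^3^3"
  have ent: "(?A ** transpose ?A) $ i $ j = (?A $ i) \<bullet> (?A $ j)" for i j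
    by (simp add: matrix_matrix_mult_def transpose_def inner_vec_def)
  have "(det ?A)\<^sup>2 = det (?A ** transpose ?A)"
    by (simp add: det_mul power2_eq_square)
  also have "\<dots> = (a \<bullet> a) * (b \<bullet> b) * (c \<bullet> c)"
    unfolding det_3 ent using assms by (simp add: inner_commute)
  finally show ?thesis .
qed

text \<open>The matrix with rows \<open>a, b, c\<close> is orthogonal, so it preserves inner products.\<close>

lemma orthonormal_frame_inner:
  fixes a b c :: "real^3"
  assumes "norm a = 1" "norm b = 1" "norm c = 1" "a \<bullet> b = 0" "a \<bullet> c = 0" "b \<bullet> c = 0"
  shows "x \<bullet> y = (x \<bullet> a) * (a \<bullet> y) + (x \<bullet> b) * (b \<bullet> y) + (x \<bullet> c) * (c \<bullet> y)"
proof -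
  let ?A = "vector [a, b, c] :: real^3^3"
  have n: "a \<bullet> a = 1" "b \<bullet> b = 1" "c \<bullet> c = 1" using assms by (simp_all add: dot_square_norm)
  have ent: "(?A ** transpose ?A) $ i $ j = (?A $ i) \<bullet> (?A $ j)" for i j
    by (simp add: matrix_matrix_mult_def transpose_def inner_vec_def)
  have "?A ** transpose ?A = mat 1"
    unfolding vec_eq_iff forall_3 ent mat_def using assms n by (simp add: inner_commute)
  then have "transpose ?A ** ?A = mat 1" by (rule matrix_left_right_inverse[THEN iffD1])
  then have "orthogonal_matrix ?A" by (simp add: orthogonal_matrix)
  then have "orthogonal_transformation ((*v) ?A)"
    unfolding orthogonal_transformation_matrix by simp
  then have "x \<bullet> y = (?A *v x) \<bullet> (?A *v y)" by (simp add: orthogonal_transformation_def)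
  also have "\<dots> = (x \<bullet> a) * (a \<bullet> y) + (x \<bullet> b) * (b \<bullet> y) + (x \<bullet> c) * (c \<bullet> y)"
    unfolding inner_vec_def[of "?A *v x"] sum_3 unfolding matrix_mult_dot by (simp add: inner_commute)
  finally show ?thesis .
qed

section \<open>Differentiating the equation of the principal curvatures\<close>

text \<open>The functions stand for \<open>E, F, G, L, M, N\<^sub>1\<close> and a principal curvature along the \<open>v\<close>-axis. Substituting
  the value of \<open>M\<^sub>v\<close> into the differentiated equation leaves, besides the two asserted products, only
  \<open>G\<^sub>v\<close> times the equation itself. The factor on the right is one twenty-fourth of the secondary cuspidal
  curvature.\<close>

lemma principal_curvature_derivative:
  fixes e f g l m n k :: "real \<Rightarrow> real"
  assumes d: "(e has_real_derivative 0) (at 0)" "(f has_real_derivative f') (at 0)"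
      "(g has_real_derivative g') (at 0)" "(l has_real_derivative 0) (at 0)"
      "(m has_real_derivative m') (at 0)" "(n has_real_derivative n') (at 0)"
      "(k has_real_derivative k') (at 0)"
    and v: "e 0 = 1" "f 0 = 0" "g 0 = 1"
    and m': "m' = l 0 * f' + m 0 * g' / 2"
    and eq: "\<forall>\<^sub>F t in nhds 0. (e t * g t - (f t)\<^sup>2) * (k t)\<^sup>2
        - (e t * n t - 2 * f t * m t + g t * l t) * k t + (l t * n t - (m t)\<^sup>2) = 0"
  shows "(2 * k 0 - (l 0 + n 0)) * k' = (n' - 2 * f' * m 0 - g' * n 0) * (k 0 - l 0)"
proof -
  define \<Phi> where "\<Phi> t = (e t * g t - (f t)\<^sup>2) * (k t)\<^sup>2
        - (e t * n t - 2 * f t * m t + g t * l t) * k t + (l t * n t - (m t)\<^sup>2)" for t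
  have D: "(\<Phi> has_real_derivative g' * (k 0)\<^sup>2 + 2 * k 0 * k'
      - (n' - 2 * f' * m 0 + g' * l 0) * k 0 - (n 0 + l 0) * k' + l 0 * n' - 2 * m 0 * m') (at 0)"
    unfolding \<Phi>_def
    by (rule derivative_eq_intros d refl)+ (simp add: v algebra_simps)
  have ev: "\<forall>\<^sub>F t in nhds 0. \<Phi> t = 0" using eq unfolding \<Phi>_def .
  have "((\<lambda>t. 0) has_real_derivative g' * (k 0)\<^sup>2 + 2 * k 0 * k'
      - (n' - 2 * f' * m 0 + g' * l 0) * k 0 - (n 0 + l 0) * k' + l 0 * n' - 2 * m 0 * m') (at 0)"
    using DERIV_cong_ev[OF refl ev refl] D by simp
  from DERIV_unique[OF this DERIV_const]
  have 0: "g' * (k 0)\<^sup>2 + 2 * k 0 * k' - (n' - 2 * f' * m 0 + g' * l 0) * k 0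
      - (n 0 + l 0) * k' + l 0 * n' - 2 * m 0 * m' = 0" .
  have 1: "(k 0)\<^sup>2 - (n 0 + l 0) * k 0 + (l 0 * n 0 - (m 0)\<^sup>2) = 0"
    using eventually_nhds_x_imp_x[OF eq] v by simp
  have "(2 * k 0 - (l 0 + n 0)) * k' - (n' - 2 * f' * m 0 - g' * n 0) * (k 0 - l 0)
      = (g' * (k 0)\<^sup>2 + 2 * k 0 * k' - (n' - 2 * f' * m 0 + g' * l 0) * k 0
      - (n 0 + l 0) * k' + l 0 * n' - 2 * m 0 * m')
      - g' * ((k 0)\<^sup>2 - (n 0 + l 0) * k 0 + (l 0 * n 0 - (m 0)\<^sup>2))"
    unfolding m' by (simp add: algebra_simps power2_eq_square)
  then show ?thesis unfolding 0 1 by simp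
qed

section \<open>Curvatures and focal surfaces at a pure-frontal singular point\<close>

text \<open>What adapted coordinates at a pure-frontal singular point with nonzero cuspidal torsion provide. The condition on
  the frame is imposed at the origin only, whereas the vanishing of \<open>g\<^sub>v\<close> and \<open>n\<^sub>v\<close> is needed along the axis,
  since it is differentiated in the direction \<open>u\<close>.\<close>

locale pure_frontal_coordinates =
  fixes W :: "(real^2) set" and g n :: "real^2 \<Rightarrow> real^3"
  assumes open_W: "open W" and zero_in_W: "0 \<in> W"
    and smooth_g: "smooth_on W g" and smooth_n: "smooth_on W n"
    and norm_n: "q \<in> W \<Longrightarrow> norm (n q) = 1"
    and pd_g_n: "q \<in> W \<Longrightarrow> pd i g q \<bullet> n q = 0"
    and g_v_axis: "q \<in> W \<Longrightarrow> q $ 2 = 0 \<Longrightarrow> pd 2 g q = 0"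
    and n_v_axis: "\<forall>\<^sub>F q in nhds 0. q $ 2 = 0 \<longrightarrow> pd 2 n q = 0"
    and frame: "norm (pd 1 g 0) = 1" "norm (pd 2 (pd 2 g) 0) = 1"
      "pd 1 g 0 \<bullet> pd 2 (pd 2 g) 0 = 0" "pd 2 (pd 2 g) 0 \<bullet> n 0 = 0"
    and torsion: "tM g n 0 \<noteq> 0"
begin

lemma eventually_in_W: "\<forall>\<^sub>F q in nhds 0. q \<in> W"
  using open_W zero_in_W by (rule eventually_nhds_in_open)

lemma differentiable_at_0:
  "g differentiable at 0" "n differentiable at 0"
  "pd i g differentiable at 0" "pd i n differentiable at 0"
  "pd j (pd i g) differentiable at 0" "pd j (pd i n) differentiable at 0"
  using smooth_g smooth_n zero_in_W smooth_on_differentiable smooth_on_pd by metis+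

lemma g_v_axis_ev: "\<forall>\<^sub>F q in nhds 0. q $ 2 = 0 \<longrightarrow> pd 2 g q = 0"
  using eventually_in_W by eventually_elim (use g_v_axis in auto)

text \<open>By symmetry these are derivatives in the direction \<open>u\<close> of \<open>g\<^sub>v\<close> and \<open>n\<^sub>v\<close>, which vanish along the axis.\<close>

lemma mixed_0: "pd 2 (pd 1 g) 0 = 0" "pd 2 (pd 1 n) 0 = 0"
  using pd_1_axis_const[OF differentiable_at_0(3) _ g_v_axis_ev] pd_1_axis_const[OF differentiable_at_0(4) _ n_v_axis]
  by (simp_all add: pd_commute[OF open_W smooth_g zero_in_W] pd_commute[OF open_W smooth_n zero_in_W])

lemma differentiable_div_v:
  assumes "smooth_on W f" "\<forall>\<^sub>F q in nhds 0. q $ 2 = 0 \<longrightarrow> pd 2 f q = 0"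
  shows "div_v (pd 2 f) differentiable at 0"
proof -
  have "\<forall>\<^sub>F q in nhds 0. pd 2 f differentiable at q"
    using eventually_in_W
    by eventually_elim (rule smooth_on_differentiable[OF smooth_on_pd[OF assms(1)]])
  moreover have "pd 2 (pd 2 f) differentiable at 0"
    by (rule smooth_on_differentiable[OF smooth_on_pd[OF smooth_on_pd[OF assms(1)]] zero_in_W])
  ultimately show ?thesis
    using div_v_has_derivative[OF _ assms(2)] unfolding differentiable_def by blast
qed

lemma h_differentiable: "h_of g differentiable at 0"
  unfolding h_of_def by (rule differentiable_div_v[OF smooth_g g_v_axis_ev])

lemma nu1_differentiable: "nu1_of n differentiable at 0"
  unfolding nu1_of_def by (rule differentiable_div_v[OF smooth_n n_v_axis])

lemma h_0: "h_of g 0 = pd 2 (pd 2 g) 0"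
  by (simp add: h_of_def div_v_def)

lemma coefficients_differentiable:
  "tE g differentiable at 0" "tF g differentiable at 0" "tG g differentiable at 0"
  "tL g n differentiable at 0" "tM g n differentiable at 0" "tN1 g n differentiable at 0"
  using differentiable_at_0 h_differentiable nu1_differentiable
  by (simp_all add: tE_def[abs_def] tF_def[abs_def] tG_def[abs_def] tL_def[abs_def] tM_def[abs_def] tN1_def[abs_def])

lemma metric_0: "tE g 0 = 1" "tF g 0 = 0" "tG g 0 = 1"
  using frame by (simp_all add: tE_def tF_def tG_def h_0 dot_square_norm)

lemma tE_v: "pd 2 (tE g) 0 = 0"
  unfolding tE_def[abs_def] by (simp add: pd_inner differentiable_at_0 mixed_0)

lemma tF_v: "pd 2 (tF g) 0 = pd 1 g 0 \<bullet> pd 2 (h_of g) 0"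
  unfolding tF_def[abs_def] by (simp add: pd_inner differentiable_at_0 h_differentiable mixed_0)

lemma tG_v: "pd 2 (tG g) 0 = 2 * (h_of g 0 \<bullet> pd 2 (h_of g) 0)"
  unfolding tG_def[abs_def] by (simp add: pd_inner h_differentiable inner_commute)

lemma tL_v: "pd 2 (tL g n) 0 = 0"
  unfolding tL_def[abs_def]
  by (subst pd_uminus) (simp_all add: pd_inner differentiable_at_0 mixed_0)

lemma n_orth_0: "pd i n 0 \<bullet> n 0 = 0"
  using pd_unit[OF open_W zero_in_W differentiable_at_0(2) norm_n] .

text \<open>Since \<open>n\<^sub>u\<^sub>v = 0\<close>, only \<open>- \<langle>h\<^sub>v, n\<^sub>u\<rangle>\<close> remains; in the frame \<open>g\<^sub>u, h, n\<close> the components of \<open>n\<^sub>u\<close> are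
  \<open>- L, - M, 0\<close>, and those of \<open>h\<^sub>v\<close> in the first two directions are \<open>F\<^sub>v\<close> and \<open>G\<^sub>v / 2\<close>.\<close>

lemma tM_v: "pd 2 (tM g n) 0 = tL g n 0 * pd 2 (tF g) 0 + tM g n 0 * pd 2 (tG g) 0 / 2"
proof -
  have "pd 2 (tM g n) 0 = - (pd 2 (h_of g) 0 \<bullet> pd 1 n 0)"
    unfolding tM_def[abs_def]
    by (subst pd_uminus) (simp_all add: pd_inner differentiable_at_0 h_differentiable mixed_0)
  also have "pd 2 (h_of g) 0 \<bullet> pd 1 n 0 = (pd 2 (h_of g) 0 \<bullet> pd 1 g 0) * (pd 1 g 0 \<bullet> pd 1 n 0)
      + (pd 2 (h_of g) 0 \<bullet> h_of g 0) * (h_of g 0 \<bullet> pd 1 n 0)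
      + (pd 2 (h_of g) 0 \<bullet> n 0) * (n 0 \<bullet> pd 1 n 0)"
    by (rule orthonormal_frame_inner)
      (use frame norm_n pd_g_n zero_in_W h_0 in \<open>auto simp: inner_commute\<close>)
  finally show ?thesis
    using n_orth_0[of 1]
    by (simp add: tF_v tG_v tL_def[of g n 0] tM_def[of g n 0] inner_commute algebra_simps)
qed

lemma curvature_differentiable:
  "mean_curvature g n differentiable at 0" "gauss_curvature g n differentiable at 0"
  unfolding mean_curvature_def[abs_def] gauss_curvature_def[abs_def]
  by (auto intro!: derivative_intros coefficients_differentiable simp: metric_0)

text \<open>At the origin \<open>H\<^sup>2 - K = ((L - N\<^sub>1) / 2)\<^sup>2 + M\<^sup>2\<close>, so nonzero torsion keeps the two principal curvatures
  distinct and the square root differentiable.\<close>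

lemma discriminant_pos: "(mean_curvature g n 0)\<^sup>2 - gauss_curvature g n 0 > 0"
proof -
  have "(mean_curvature g n 0)\<^sup>2 - gauss_curvature g n 0
      = ((tL g n 0 - tN1 g n 0) / 2)\<^sup>2 + (tM g n 0)\<^sup>2"
    by (simp add: mean_curvature_def gauss_curvature_def metric_0 power2_eq_square field_simps)
  also have "\<dots> > 0" using torsion by (simp add: add_nonneg_pos)
  finally show ?thesis .
qed

lemma principal_curvature_differentiable: "principal_curvature j g n differentiable at 0"
proof -
  have "(\<lambda>q. (mean_curvature g n q)\<^sup>2 - gauss_curvature g n q) differentiable at 0"
    by (intro derivative_intros curvature_differentiable)
  then obtain D where "((\<lambda>q. (mean_curvature g n q)\<^sup>2 - gauss_curvature g n q) has_derivative D) (at 0)"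
    unfolding differentiable_def by blast
  from has_derivative_real_sqrt(1)[OF discriminant_pos this]
  have "(\<lambda>q. sqrt ((mean_curvature g n q)\<^sup>2 - gauss_curvature g n q)) differentiable at 0"
    unfolding differentiable_def by blast
  then show ?thesis
    unfolding principal_curvature_def[abs_def]
    by (cases "j = 1") (simp_all add: curvature_differentiable)
qed

lemma principal_curvature_equation:
  "\<forall>\<^sub>F q in nhds 0. (tE g q * tG g q - (tF g q)\<^sup>2) * (principal_curvature j g n q)\<^sup>2
     - (tE g q * tN1 g n q - 2 * tF g q * tM g n q + tG g q * tL g n q) * principal_curvature j g n q
     + (tL g n q * tN1 g n q - (tM g n q)\<^sup>2) = 0"
proof -
  have cont: "\<forall>\<^sub>F q in nhds 0. \<psi> q > 0" if "\<psi> differentiable at 0" "\<psi> 0 > 0" for \<psi> :: "real^2 \<Rightarrow> real"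
  proof -
    have "(\<psi> \<longlongrightarrow> \<psi> 0) (nhds 0)"
      using differentiable_imp_continuous_within[OF that(1)] by (simp add: isCont_def tendsto_at_iff_tendsto_nhds)
    then show ?thesis using order_tendstoD(1) that(2) by blast
  qed
  have "\<forall>\<^sub>F q in nhds 0. tE g q * tG g q - (tF g q)\<^sup>2 > 0"
    by (rule cont) (auto intro!: derivative_intros coefficients_differentiable simp: metric_0)
  moreover have "\<forall>\<^sub>F q in nhds 0. (mean_curvature g n q)\<^sup>2 - gauss_curvature g n q > 0"
    by (rule cont, intro derivative_intros curvature_differentiable, rule discriminant_pos)
  ultimately show ?thesis
  proof eventually_elim
    case (elim q)
    define H K k where "H = mean_curvature g n q" and "K = gauss_curvature g n q"
      and "k = principal_curvature j g n q"
    define d where "d = tE g q * tG g q - (tF g q)\<^sup>2"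
    have d: "d > 0" using elim(1) by (simp add: d_def)
    have "k - H = sqrt (H\<^sup>2 - K) \<or> k - H = - sqrt (H\<^sup>2 - K)"
      by (simp add: k_def H_def K_def principal_curvature_def)
    moreover have "(sqrt (H\<^sup>2 - K))\<^sup>2 = H\<^sup>2 - K" using elim(2) by (simp add: H_def K_def)
    ultimately have "(k - H)\<^sup>2 = H\<^sup>2 - K" by (metis power2_minus)
    then have q: "k\<^sup>2 - 2 * H * k + K = 0" by (simp add: power2_eq_square algebra_simps)
    have H: "2 * H * d = tE g q * tN1 g n q - 2 * tF g q * tM g n q + tG g q * tL g n q"
      unfolding H_def mean_curvature_def d_def[symmetric] using d by simp
    have K: "K * d = tL g n q * tN1 g n q - (tM g n q)\<^sup>2"
      unfolding K_def gauss_curvature_def d_def[symmetric] using d by simp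
    have "d * k\<^sup>2 - 2 * H * d * k + K * d = d * (k\<^sup>2 - 2 * H * k + K)" by (simp add: algebra_simps)
    then have "d * k\<^sup>2 - 2 * H * d * k + K * d = 0" using q by simp
    then show ?case unfolding H K unfolding d_def k_def .
  qed
qed

lemma principal_curvature_v:
  "(2 * principal_curvature j g n 0 - (tL g n 0 + tN1 g n 0)) * pd 2 (principal_curvature j g n) 0
   = (pd 2 (tN1 g n) 0 - 2 * pd 2 (tF g) 0 * tM g n 0 - pd 2 (tG g) 0 * tN1 g n 0)
     * (principal_curvature j g n 0 - tL g n 0)"
proof -
  have D: "((\<lambda>t. \<psi> (t *\<^sub>R axis 2 1)) has_real_derivative pd 2 \<psi> 0) (at 0)"
    if "\<psi> differentiable at 0" for \<psi> :: "real^2 \<Rightarrow> real"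
    using pd_has_vector_derivative[OF that, of 2] by (simp add: has_real_derivative_iff_has_vector_derivative)
  have "filterlim (\<lambda>t. t *\<^sub>R axis 2 1) (nhds (0 *\<^sub>R axis 2 (1::real) :: real^2)) (nhds (0::real))"
    by (intro tendsto_scaleR tendsto_const) (simp add: filterlim_ident)
  then have lim: "filterlim (\<lambda>t. t *\<^sub>R axis 2 1) (nhds (0 :: real^2)) (nhds (0::real))" by simp
  note c = coefficients_differentiable
  show ?thesis
    using principal_curvature_derivative[OF D[OF c(1), unfolded tE_v] D[OF c(2)] D[OF c(3)]
        D[OF c(4), unfolded tL_v] D[OF c(5)] D[OF c(6)] D[OF principal_curvature_differentiable[of j]]
        _ _ _ _ eventually_compose_filterlim[OF principal_curvature_equation[of j] lim]]
    by (simp add: metric_0 tM_v)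
qed

text \<open>The equation at the origin reads \<open>(\<kappa> - L) (\<kappa> - N\<^sub>1) = M\<^sup>2\<close>, which is positive. So \<open>\<kappa> - L\<close> is nonzero and
  has the sign of \<open>\<kappa> - N\<^sub>1\<close>; thus their sum \<open>2 \<kappa> - (L + N\<^sub>1)\<close> is nonzero as well.\<close>

lemma principal_curvature_v_eq_0_iff:
  "pd 2 (principal_curvature j g n) 0 = 0 \<longleftrightarrow> secondary_cuspidal_curvature g n 0 = 0"
proof -
  let ?k = "principal_curvature j g n 0" and ?l = "tL g n 0" and ?n = "tN1 g n 0"
  have "?k\<^sup>2 - (?n + ?l) * ?k + (?l * ?n - (tM g n 0)\<^sup>2) = 0"
    using eventually_nhds_x_imp_x[OF principal_curvature_equation[of j]] by (simp add: metric_0)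
  then have "(?k - ?l) * (?k - ?n) = (tM g n 0)\<^sup>2" by (simp add: power2_eq_square algebra_simps)
  then have pos: "(?k - ?l) * (?k - ?n) > 0" using torsion by simp
  then have 1: "?k - ?l \<noteq> 0" by auto
  have 2: "2 * ?k - (?l + ?n) \<noteq> 0"
    using pos unfolding zero_less_mult_iff by linarith
  have "vector [0, 0] = (0 :: real^2)" by (simp add: vec_eq_iff forall_2)
  then have "secondary_cuspidal_curvature g n 0 = 24 * (
      pd 2 (tN1 g n) 0 - 2 * pd 2 (tF g) 0 * tM g n 0 - pd 2 (tG g) 0 * tN1 g n 0)"
    by (simp add: secondary_cuspidal_curvature_def Let_def)
  then have "secondary_cuspidal_curvature g n 0 = 0 \<longleftrightarrow>
      (pd 2 (tN1 g n) 0 - 2 * pd 2 (tF g) 0 * tM g n 0 - pd 2 (tG g) 0 * tN1 g n 0) * (?k - ?l) = 0"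
    using 1 by (simp only: mult_eq_0_iff) simp
  then show ?thesis unfolding principal_curvature_v[of j, symmetric] using 2 by simp
qed

text \<open>At the origin the \<open>v\<close>-derivative of the focal surface is a multiple of the normal, and its \<open>u\<close>-derivative has
  the nonzero component \<open>- \<rho> M\<close> in the direction \<open>h\<close>; the rank drops only if the \<open>v\<close>-derivative vanishes.\<close>

lemma focal_surface_singular_iff:
  assumes k: "principal_curvature j g n 0 \<noteq> 0"
  shows "0 \<in> sing_set (focal_surface j g n) \<longleftrightarrow> secondary_cuspidal_curvature g n 0 = 0"
proof -
  define C where "C = focal_surface j g n"
  define \<rho> where "\<rho> q = 1 / principal_curvature j g n q" for q
  define k' where "k' = frechet_derivative (principal_curvature j g n) (at 0)"
  have k': "(principal_curvature j g n has_derivative k') (at 0)"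
    using principal_curvature_differentiable unfolding k'_def by (simp add: frechet_derivative_works)
  have \<rho>: "(\<rho> has_derivative (\<lambda>w. - k' w / (principal_curvature j g n 0)\<^sup>2)) (at 0)"
    unfolding \<rho>_def by (rule derivative_eq_intros k' refl k)+ (simp add: power2_eq_square)
  have C: "(C has_derivative (\<lambda>w. frechet_derivative g (at 0) w
      + (\<rho> 0 *\<^sub>R frechet_derivative n (at 0) w - (k' w / (principal_curvature j g n 0)\<^sup>2) *\<^sub>R n 0))) (at 0)"
    unfolding C_def focal_surface_def[abs_def] \<rho>_def[symmetric]
    by (rule has_derivative_eq_rhs, rule has_derivative_add, rule differentiable_at_0(1)[unfolded frechet_derivative_works],
       rule has_derivative_scaleR, rule \<rho>, rule differentiable_at_0(2)[unfolded frechet_derivative_works]) simp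
  have dC: "C differentiable at 0" using C unfolding differentiable_def by blast
  have "pd 2 n 0 = 0" using eventually_nhds_x_imp_x[OF n_v_axis] by simp
  then have C2: "pd 2 C 0 = - (pd 2 (principal_curvature j g n) 0 / (principal_curvature j g n 0)\<^sup>2) *\<^sub>R n 0"
    using g_v_axis[OF zero_in_W] by (simp add: pd_eqI[OF C] k'_def flip: pd_def)
  have h: "h_of g 0 \<bullet> n 0 = 0" "h_of g 0 \<bullet> pd 1 g 0 = 0" using frame by (simp_all add: h_0 inner_commute)
  have "h_of g 0 \<bullet> pd 1 C 0 = - \<rho> 0 * tM g n 0"
    by (simp add: pd_eqI[OF C] inner_add_right inner_diff_right h tM_def flip: pd_def)
  then have C1: "h_of g 0 \<bullet> pd 1 C 0 \<noteq> 0" using k torsion by (simp add: \<rho>_def)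
  have "0 \<in> sing_set C \<longleftrightarrow> pd 2 C 0 = 0"
  proof
    assume "0 \<in> sing_set C"
    then obtain w :: "real^2" where w: "w \<noteq> 0" "(w $ 1) *\<^sub>R pd 1 C 0 + (w $ 2) *\<^sub>R pd 2 C 0 = 0"
      unfolding sing_set_iff[OF dC] by (auto simp: frechet_derivative_pd[OF dC])
    then have "h_of g 0 \<bullet> ((w $ 1) *\<^sub>R pd 1 C 0 + (w $ 2) *\<^sub>R pd 2 C 0) = 0" by simp
    then have "w $ 1 = 0" using C1 h by (simp add: inner_add_right inner_diff_right C2)
    moreover from this have "w $ 2 \<noteq> 0" using w(1) by (simp add: vec_eq_iff forall_2)
    ultimately show "pd 2 C 0 = 0" using w(2) by simp
  next
    assume "pd 2 C 0 = 0"
    then show "0 \<in> sing_set C"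
      unfolding sing_set_iff[OF dC] by (intro exI[of _ "axis 2 1"]) (auto simp: pd_def axis_eq_0_iff)
  qed
  also have "pd 2 C 0 = 0 \<longleftrightarrow> pd 2 (principal_curvature j g n) 0 = 0"
    using norm_n[OF zero_in_W] k unfolding C2 by (auto simp: scaleR_eq_0_iff)
  finally show ?thesis unfolding C_def principal_curvature_v_eq_0_iff .
qed

end

section \<open>The normal along the singular curve\<close>

text \<open>The function is positive shortly after \<open>0\<close> and negative shortly before, so the intermediate value theorem applies.\<close>

lemma surj_near_0_if_deriv_pos:
  fixes c :: "real \<Rightarrow> real"
  assumes "(c has_real_derivative m) (at 0)" "m > 0" "c 0 = 0" "\<delta> > 0"
    and cont: "continuous_on {-\<delta><..<\<delta>} c"
  shows "\<exists>r>0. \<forall>u. \<bar>u\<bar> < r \<longrightarrow> (\<exists>t\<in>{-\<delta><..<\<delta>}. c t = u)"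
proof -
  obtain d1 where d1: "d1 > 0" "\<And>h. 0 < h \<Longrightarrow> h < d1 \<Longrightarrow> c 0 < c (0 + h)"
    using DERIV_pos_inc_right[OF assms(1,2)] by blast
  obtain d2 where d2: "d2 > 0" "\<And>h. 0 < h \<Longrightarrow> h < d2 \<Longrightarrow> c (0 - h) < c 0"
    using DERIV_pos_inc_left[OF assms(1,2)] by blast
  define a where "a = min (min d1 d2) \<delta> / 2"
  have a: "0 < a" "a < d1" "a < d2" "a < \<delta>" using d1(1) d2(1) assms(4) by (auto simp: a_def)
  have pos: "c a > 0" and neg: "c (-a) < 0" using d1(2)[of a] d2(2)[of a] a assms(3) by auto
  have "connected (c ` {-\<delta><..<\<delta>})"
    by (intro connected_continuous_image cont) simp
  moreover have "c (-a) \<in> c ` {-\<delta><..<\<delta>}" "c a \<in> c ` {-\<delta><..<\<delta>}"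
    using a by auto
  ultimately have "{c (-a)..c a} \<subseteq> c ` {-\<delta><..<\<delta>}" by (rule connected_contains_Icc)
  then have "\<exists>t\<in>{-\<delta><..<\<delta>}. c t = u" if "\<bar>u\<bar> < min (c a) (- c (-a))" for u
  proof -
    have "u \<in> {c (-a)..c a}" using that by (simp add: abs_less_iff)
    then show ?thesis using \<open>{c (-a)..c a} \<subseteq> _\<close> by blast
  qed
  then show ?thesis
    using pos neg by (intro exI[of _ "min (c a) (- c (-a))"]) simp
qed

lemma surj_near_0_if_deriv_nonzero:
  fixes c :: "real \<Rightarrow> real"
  assumes "(c has_real_derivative m) (at 0)" "m \<noteq> 0" "c 0 = 0" "\<delta> > 0"
    and "continuous_on {-\<delta><..<\<delta>} c"
  shows "\<exists>r>0. \<forall>u. \<bar>u\<bar> < r \<longrightarrow> (\<exists>t\<in>{-\<delta><..<\<delta>}. c t = u)"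
proof (cases "m > 0")
  case True
  then show ?thesis using surj_near_0_if_deriv_pos assms by blast
next
  case False
  have "\<exists>r>0. \<forall>u. \<bar>u\<bar> < r \<longrightarrow> (\<exists>t\<in>{-\<delta><..<\<delta>}. - c t = u)"
    using False assms
    by (intro surj_near_0_if_deriv_pos[of _ "- m"]) (auto intro: DERIV_minus continuous_intros)
  then show ?thesis by (metis abs_minus_cancel minus_minus)
qed

lemma frechet_derivative_comp:
  assumes "\<phi> differentiable at q" "f differentiable at (\<phi> q)"
  shows "frechet_derivative (f \<circ> \<phi>) (at q) w = frechet_derivative f (at (\<phi> q)) (frechet_derivative \<phi> (at q) w)"
  using frechet_derivative_compose[OF assms] by simp

lemma coordinate_change_inverse:
  assumes "coordinate_change W U \<phi>"
  obtains \<phi>' where "smooth_on (\<phi> ` W) \<phi>'" "\<And>q. q \<in> W \<Longrightarrow> \<phi>' (\<phi> q) = q"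
    "\<And>q z. q \<in> W \<Longrightarrow> frechet_derivative \<phi> (at q) (frechet_derivative \<phi>' (at (\<phi> q)) z) = z"
proof -
  obtain \<phi>' where \<phi>': "smooth_on (\<phi> ` W) \<phi>'" "\<And>q. q \<in> W \<Longrightarrow> \<phi>' (\<phi> q) = q"
    using assms unfolding coordinate_change_def by auto
  have "frechet_derivative \<phi> (at q) (frechet_derivative \<phi>' (at (\<phi> q)) z) = z" if q: "q \<in> W" for q z
  proof -
    have "smooth_on W \<phi>" using assms unfolding coordinate_change_def by blast
    then have d: "\<phi>' differentiable at (\<phi> q)" "\<phi> differentiable at (\<phi>' (\<phi> q))"
      using smooth_on_differentiable[OF \<phi>'(1)] smooth_on_differentiable[of W \<phi>] \<phi>'(2) q by simp_all
    have "frechet_derivative (\<lambda>x. x) (at (\<phi> q)) = frechet_derivative (\<phi> \<circ> \<phi>') (at (\<phi> q))"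
      using assms q \<phi>'(2) unfolding coordinate_change_def
      by (intro frechet_derivative_transform_within_open[of _ _ "\<phi> ` W"]) auto
    then have "frechet_derivative (\<phi> \<circ> \<phi>') (at (\<phi> q)) z = z" by (metis frechet_derivative_ident)
    then show ?thesis using frechet_derivative_comp[OF d] \<phi>'(2)[OF q] by simp
  qed
  with \<phi>' show ?thesis using that by blast
qed

text \<open>Differentiating \<open>\<langle>g\<^sub>u, n\<rangle> = 0\<close> in \<open>v\<close> and \<open>\<langle>g\<^sub>v, n\<rangle> = 0\<close> in \<open>u\<close> gives
  \<open>\<langle>g\<^sub>u, n\<^sub>v\<rangle> = - \<langle>g\<^sub>u\<^sub>v, n\<rangle> = \<langle>g\<^sub>v, n\<^sub>u\<rangle>\<close>.\<close>

lemma normal_v_orthogonal: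
  fixes g n :: "real^2 \<Rightarrow> 'a::real_inner"
  assumes "open W" "q \<in> W" "smooth_on W g" "smooth_on W n"
    and "\<And>x i. x \<in> W \<Longrightarrow> pd i g x \<bullet> n x = 0"
    and "pd 2 g q = 0"
  shows "pd 1 g q \<bullet> pd 2 n q = 0"
proof -
  note d = smooth_on_differentiable[OF smooth_on_pd[OF assms(3)] assms(2)] smooth_on_differentiable[OF assms(4,2)]
  have "pd i (\<lambda>x. pd j g x \<bullet> n x) q = 0" for i j
    by (rule pd_const_on_open[OF assms(1,2,5)])
  then have *: "pd i (pd j g) q \<bullet> n q + pd j g q \<bullet> pd i n q = 0" for i j
    by (simp add: pd_inner d)
  show ?thesis
    using *[of 2 1] *[of 1 2] assms(6) pd_commute[OF assms(1,3,2), of 1 2] by simp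
qed

text \<open>The condition \<open>\<psi> = 0\<close> refers to some singular curve \<open>\<gamma>\<close> and null vector field \<open>\<eta>\<close> in the original
  coordinates and has to be carried over. Pulled back, \<open>\<gamma>\<close> becomes a curve \<open>c\<close> in the \<open>u\<close>-axis
  with nonvanishing velocity, which therefore covers the axis near the origin; and \<open>\<eta>\<close> becomes a nonzero multiple of
  \<open>\<partial>\<^sub>v\<close>, because the derivative of \<open>f \<circ> \<phi>\<close> has kernel spanned by \<open>\<partial>\<^sub>v\<close> there. So \<open>\<psi> = 0\<close> becomes
  \<open>det(g\<^sub>u, n, n\<^sub>v) = 0\<close>. The three vectors are pairwise orthogonal and the first two are unit vectors, whence \<open>n\<^sub>v = 0\<close>.\<close>

lemma normal_v_vanishes_on_axis:
  fixes f \<nu> :: "real^2 \<Rightarrow> real^3"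
  assumes frontal: "frontal_on U f \<nu>" and pure: "pure_frontal_point U f \<nu> p"
    and adapted: "adapted_coordinates U f \<nu> p W \<phi>"
  shows "\<forall>\<^sub>F q in nhds 0. q $ 2 = 0 \<longrightarrow> pd 2 (\<nu> \<circ> \<phi>) q = 0"
proof -
  define g n where "g = f \<circ> \<phi>" and "n = \<nu> \<circ> \<phi>"
  from frontal have sf: "smooth_on U f" and s\<nu>: "smooth_on U \<nu>" unfolding frontal_on_def by auto
  from adapted have cc: "coordinate_change W U \<phi>" and W0: "0 \<in> W" "\<phi> 0 = p"
    and sing: "sing_set g \<inter> W = {q \<in> W. q $ 2 = 0}"
    unfolding adapted_coordinates_def g_def by auto
  from cc have oW: "open W" and WU: "\<phi> ` W \<subseteq> U" and o\<phi>: "open (\<phi> ` W)" and s\<phi>: "smooth_on W \<phi>"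
    unfolding coordinate_change_def by auto
  have d\<phi>: "\<phi> differentiable at q" "f differentiable at (\<phi> q)" "\<nu> differentiable at (\<phi> q)" if "q \<in> W" for q
    using that WU smooth_on_differentiable s\<phi> sf s\<nu> by blast+
  have axis: "pd 2 g q = 0" "norm (pd 1 g q) = 1" if "q \<in> W" "q $ 2 = 0" for q
    using adapted that unfolding adapted_coordinates_def Let_def g_def by auto
  have sg: "smooth_on W g" and sn: "smooth_on W n"
    unfolding g_def n_def using smooth_on_compose[OF oW WU s\<phi>] sf s\<nu> by auto
  have Dg: "frechet_derivative g (at q) w = frechet_derivative f (at (\<phi> q)) (frechet_derivative \<phi> (at q) w)"
    and Dn: "frechet_derivative n (at q) w = frechet_derivative \<nu> (at (\<phi> q)) (frechet_derivative \<phi> (at q) w)"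
    if "q \<in> W" for q w
    unfolding g_def n_def using frechet_derivative_comp d\<phi> that by blast+
  have unit: "norm (n q) = 1" and orth: "pd i g q \<bullet> n q = 0" if "q \<in> W" for i q
    using frontal WU that Dg[OF that] unfolding frontal_on_def pd_def by (auto simp: n_def)
  obtain \<phi>' where \<phi>': "smooth_on (\<phi> ` W) \<phi>'" "\<And>q. q \<in> W \<Longrightarrow> \<phi>' (\<phi> q) = q"
    "\<And>q z. q \<in> W \<Longrightarrow> frechet_derivative \<phi> (at q) (frechet_derivative \<phi>' (at (\<phi> q)) z) = z"
    using coordinate_change_inverse[OF cc] by blast
  obtain \<epsilon> \<gamma> \<eta> where sc: "singular_curve U f p \<epsilon> \<gamma>" and nv: "null_vector_field f \<epsilon> \<gamma> \<eta>"
    and psi: "\<And>t. t \<in> {-\<epsilon><..<\<epsilon>} \<Longrightarrow> psi f \<nu> \<gamma> \<eta> t = 0"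
    using pure unfolding pure_frontal_point_def by blast
  define \<gamma>' where "\<gamma>' t = vector_derivative \<gamma> (at t)" for t
  have \<epsilon>: "\<epsilon> > 0" and \<gamma>0: "\<gamma> 0 = p"
    and \<gamma>': "\<And>t. t \<in> {-\<epsilon><..<\<epsilon>} \<Longrightarrow> \<gamma>' t \<noteq> 0"
    and \<gamma>s: "\<And>t. t \<in> {-\<epsilon><..<\<epsilon>} \<Longrightarrow> \<gamma> t \<in> sing_set f"
    and s\<gamma>: "smooth_on {-\<epsilon><..<\<epsilon>} \<gamma>"
    using sc unfolding singular_curve_def \<gamma>'_def by auto
  have \<gamma>d: "(\<gamma> has_derivative (\<lambda>s. s *\<^sub>R \<gamma>' t)) (at t)" if "t \<in> {-\<epsilon><..<\<epsilon>}" for t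
    using smooth_on_differentiable[OF s\<gamma> that] vector_derivative_works
    unfolding \<gamma>'_def has_vector_derivative_def by blast
  have \<eta>: "\<eta> (\<gamma> t) \<noteq> 0" "frechet_derivative f (at (\<gamma> t)) (\<eta> (\<gamma> t)) = 0" if "t \<in> {-\<epsilon><..<\<epsilon>}" for t
    using nv that unfolding null_vector_field_def by blast+
  have "\<forall>\<^sub>F t in nhds 0. \<gamma> t \<in> \<phi> ` W"
  proof -
    have "isCont \<gamma> 0" using \<gamma>d[of 0] \<epsilon> has_derivative_continuous by auto
    then have "(\<gamma> \<longlongrightarrow> \<gamma> 0) (nhds 0)" by (simp add: isCont_def tendsto_at_iff_tendsto_nhds)
    moreover have "\<gamma> 0 \<in> \<phi> ` W" using \<gamma>0 W0 imageI[of 0 W \<phi>] by simp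
    ultimately show ?thesis using topological_tendstoD o\<phi> by blast
  qed
  then obtain \<delta>0 where \<delta>0: "\<delta>0 > 0" "\<And>t. \<bar>t\<bar> < \<delta>0 \<Longrightarrow> \<gamma> t \<in> \<phi> ` W"
    unfolding eventually_nhds_metric by (auto simp: dist_norm)
  define \<delta> where "\<delta> = min \<delta>0 \<epsilon>"
  have \<delta>: "\<delta> > 0" "\<And>t. t \<in> {-\<delta><..<\<delta>} \<Longrightarrow> \<gamma> t \<in> \<phi> ` W" "\<And>t. t \<in> {-\<delta><..<\<delta>} \<Longrightarrow> t \<in> {-\<epsilon><..<\<epsilon>}"
    using \<delta>0 \<epsilon> by (auto simp: \<delta>_def)
  \<comment> \<open>the singular curve and its velocity in the adapted coordinates\<close>
  define c where "c t = \<phi>' (\<gamma> t)" for t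
  define c' where "c' t = frechet_derivative \<phi>' (at (\<gamma> t)) (\<gamma>' t)" for t
  have cW: "c t \<in> W" and \<phi>c: "\<phi> (c t) = \<gamma> t" if "t \<in> {-\<delta><..<\<delta>}" for t
    using \<delta>(2)[OF that] \<phi>'(2) by (auto simp: c_def)
  have lin_inj: "z = 0" if "frechet_derivative \<phi>' (at (\<gamma> t)) z = 0" "t \<in> {-\<delta><..<\<delta>}" for t z
    using \<phi>'(3)[OF cW[OF that(2)], of z] that \<phi>c[OF that(2)]
      linear_0[OF linear_frechet_derivative[OF d\<phi>(1)[OF cW[OF that(2)]]]] by simp
  have c2: "c t $ 2 = 0" if t: "t \<in> {-\<delta><..<\<delta>}" for t
  proof -
    obtain w where w: "w \<noteq> 0" "frechet_derivative f (at (\<gamma> t)) w = 0"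
      using \<gamma>s[OF \<delta>(3)[OF t]] sing_set_iff[OF d\<phi>(2)[OF cW[OF t]]] \<phi>c[OF t] by auto
    have "frechet_derivative g (at (c t)) (frechet_derivative \<phi>' (at (\<gamma> t)) w) = 0"
      using Dg[OF cW[OF t]] \<phi>'(3)[OF cW[OF t]] \<phi>c[OF t] w by simp
    then have "c t \<in> sing_set g"
      using sing_set_iff[OF smooth_on_differentiable[OF sg cW[OF t]]] lin_inj[OF _ t] w(1) by blast
    then show ?thesis using sing cW[OF t] by blast
  qed
  have cd: "(c has_derivative (\<lambda>s. s *\<^sub>R c' t)) (at t)" if t: "t \<in> {-\<delta><..<\<delta>}" for t
  proof -
    have d: "\<phi>' differentiable at (\<gamma> t)" using smooth_on_differentiable[OF \<phi>'(1) \<delta>(2)[OF t]] .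
    show ?thesis
      using has_derivative_compose[OF \<gamma>d[OF \<delta>(3)[OF t]] d[unfolded frechet_derivative_works]]
      by (simp add: c_def[abs_def] c'_def linear_scale[OF linear_frechet_derivative[OF d]])
  qed
  have ci: "((\<lambda>t. c t $ i) has_real_derivative c' t $ i) (at t)" if t: "t \<in> {-\<delta><..<\<delta>}" for t i
    using bounded_linear.has_derivative[OF bounded_linear_vec_nth cd[OF t], of i]
    by (simp add: has_field_derivative_def mult_commute_abs)
  have c'2: "c' t $ 2 = 0" if t: "t \<in> {-\<delta><..<\<delta>}" for t
  proof -
    have "((\<lambda>t. 0) has_real_derivative c' t $ 2) (at t)"
      using has_derivative_transform_within_open[OF ci[OF t, of 2, unfolded has_field_derivative_def]
          open_greaterThanLessThan t, of "\<lambda>_. 0"] c2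
      by (simp add: has_field_derivative_def)
    then show ?thesis using DERIV_unique DERIV_const by blast
  qed
  have c'1: "c' t $ 1 \<noteq> 0" if t: "t \<in> {-\<delta><..<\<delta>}" for t
  proof
    assume "c' t $ 1 = 0"
    then have "c' t = 0" using c'2[OF t] by (simp add: vec_eq_iff forall_2)
    then show False using lin_inj[OF _ t] \<gamma>'[OF \<delta>(3)[OF t]] by (simp add: c'_def)
  qed
  have "\<exists>r>0. \<forall>u. \<bar>u\<bar> < r \<longrightarrow> (\<exists>t\<in>{-\<delta><..<\<delta>}. c t $ 1 = u)"
  proof (rule surj_near_0_if_deriv_nonzero[OF ci c'1])
    show "c 0 $ 1 = 0" using \<phi>'(2)[OF W0(1)] W0(2) \<gamma>0 by (simp add: c_def)
    show "continuous_on {-\<delta><..<\<delta>} (\<lambda>t. c t $ 1)"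
      using ci DERIV_isCont by (intro continuous_at_imp_continuous_on) blast
  qed (use \<delta> in auto)
  then obtain r where r: "r > 0" "\<And>u. \<bar>u\<bar> < r \<Longrightarrow> \<exists>t\<in>{-\<delta><..<\<delta>}. c t $ 1 = u" by blast
  have main: "pd 2 n (c t) = 0" if t: "t \<in> {-\<delta><..<\<delta>}" for t
  proof -
    define q where "q = c t"
    have q: "q \<in> W" "\<phi> q = \<gamma> t" "q $ 2 = 0" using cW c2 \<phi>c t by (auto simp: q_def)
    have dg: "g differentiable at q" and dn: "n differentiable at q"
      using smooth_on_differentiable sg sn q by blast+
    \<comment> \<open>the null vector in the adapted coordinates\<close>
    define w where "w = frechet_derivative \<phi>' (at (\<gamma> t)) (\<eta> (\<gamma> t))"
    have \<phi>w: "frechet_derivative \<phi> (at q) w = \<eta> (\<gamma> t)"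
      using \<phi>'(3)[OF q(1)] q(2) by (simp add: w_def)
    have "frechet_derivative g (at q) w = 0"
      using Dg[OF q(1)] \<phi>w q(2) \<eta>(2)[OF \<delta>(3)[OF t]] by simp
    then have "w $ 1 = 0"
      using axis[OF q(1,3)] by (auto simp: frechet_derivative_pd[OF dg])
    moreover have "w \<noteq> 0" using lin_inj[OF _ t] \<eta>(1)[OF \<delta>(3)[OF t]] by (auto simp: w_def)
    ultimately have w2: "w $ 1 = 0" "w $ 2 \<noteq> 0" by (auto simp: vec_eq_iff forall_2)
    have 1: "vector_derivative (f \<circ> \<gamma>) (at t) = (c' t $ 1) *\<^sub>R pd 1 g q"
    proof -
      have df: "f differentiable at (\<gamma> t)" using d\<phi>(2)[OF q(1)] q(2) by simp
      have "((f \<circ> \<gamma>) has_vector_derivative frechet_derivative f (at (\<gamma> t)) (\<gamma>' t)) (at t)"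
        using has_derivative_compose[OF \<gamma>d[OF \<delta>(3)[OF t]] df[unfolded frechet_derivative_works]]
        by (simp add: has_vector_derivative_def o_def linear_scale[OF linear_frechet_derivative[OF df]])
      then have "vector_derivative (f \<circ> \<gamma>) (at t) = frechet_derivative f (at (\<gamma> t)) (\<gamma>' t)"
        by (rule vector_derivative_at)
      also have "\<dots> = frechet_derivative g (at q) (c' t)"
        using Dg[OF q(1)] \<phi>'(3)[OF q(1)] q(2) by (simp add: c'_def)
      finally show ?thesis using c'2[OF t] by (simp add: frechet_derivative_pd[OF dg])
    qed
    have 2: "frechet_derivative \<nu> (at (\<gamma> t)) (\<eta> (\<gamma> t)) = (w $ 2) *\<^sub>R pd 2 n q"
      using Dn[OF q(1), of w] \<phi>w q(2) w2 by (simp add: frechet_derivative_pd[OF dn])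
    have det0: "det (vector [(c' t $ 1) *\<^sub>R pd 1 g q, n q, (w $ 2) *\<^sub>R pd 2 n q] :: real^3^3) = 0"
      using psi[OF \<delta>(3)[OF t]] unfolding psi_def 1 2 by (simp add: n_def q(2))
    have o1: "pd 1 g q \<bullet> pd 2 n q = 0"
      using normal_v_orthogonal[OF oW q(1) sg sn orth axis(1)[OF q(1,3)]] .
    have o2: "pd 2 n q \<bullet> n q = 0" using pd_unit[OF oW q(1) dn unit] .
    have "(c' t $ 1)\<^sup>2 * ((w $ 2)\<^sup>2 * (pd 2 n q \<bullet> pd 2 n q)) = 0"
      using orthogonal_det_square[of "(c' t $ 1) *\<^sub>R pd 1 g q" "n q" "(w $ 2) *\<^sub>R pd 2 n q", unfolded det0]
        o1 o2 orth[OF q(1), of 1] axis(2)[OF q(1,3)] unit[OF q(1)]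
      by (simp add: inner_commute dot_square_norm power2_eq_square)
    then show ?thesis using c'1[OF t] w2 by (simp add: q_def)
  qed
  have "\<forall>\<^sub>F q in nhds (0::real^2). norm q < r"
    using r(1) unfolding eventually_nhds_metric by (auto intro!: exI[of _ r])
  then show ?thesis
  proof eventually_elim
    case (elim q)
    show ?case
    proof
      assume q2: "q $ 2 = 0"
      have "\<bar>q $ 1\<bar> < r" using component_le_norm_cart[of q 1] elim by linarith
      then obtain t where t: "t \<in> {-\<delta><..<\<delta>}" "c t $ 1 = q $ 1" using r(2) by blast
      then have "c t = q" using c2[OF t(1)] q2 by (simp add: vec_eq_iff forall_2)
      then show "pd 2 (\<nu> \<circ> \<phi>) q = 0" using main[OF t(1)] by (simp add: n_def)
    qed
  qed
qed

section \<open>The focal surface\<close>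

theorem proposition4p3:
  fixes f \<nu> g n :: "real^2 \<Rightarrow> real^3" and \<phi> :: "real^2 \<Rightarrow> real^2" and U W :: "(real^2) set"
  assumes "open U" "0 \<in> U" "frontal_on U f \<nu>" "f 0 = 0"
    and "pure_frontal_point U f \<nu> 0"
    and "adapted_coordinates U f \<nu> 0 W \<phi>"
    and "g = f \<circ> \<phi>" "n = \<nu> \<circ> \<phi>"
    and "\<forall>j\<in>{1, 2}. \<forall>\<^sub>F q in nhds 0. principal_curvature j g n q \<noteq> 0"
    and "cuspidal_torsion g n 0 \<noteq> 0"
  shows "\<forall>j\<in>{1, 2}. 0 \<in> sing_set (focal_surface j g n) \<longleftrightarrow> secondary_cuspidal_curvature g n 0 = 0"
proof -
  note g = assms(7) and n = assms(8)
  from assms(6) have cc: "coordinate_change W U \<phi>" and W0: "0 \<in> W"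
    unfolding adapted_coordinates_def by auto
  from cc have oW: "open W" and WU: "\<phi> ` W \<subseteq> U" and s\<phi>: "smooth_on W \<phi>"
    unfolding coordinate_change_def by auto
  from assms(3) have sf: "smooth_on U f" and s\<nu>: "smooth_on U \<nu>"
    and fr: "\<And>q X. q \<in> U \<Longrightarrow> frechet_derivative f (at q) X \<bullet> \<nu> q = 0" "\<And>q. q \<in> U \<Longrightarrow> norm (\<nu> q) = 1"
    unfolding frontal_on_def by auto
  have axis: "pd 2 g q = 0 \<and> norm (pd 1 g q) = 1 \<and> norm (pd 2 (pd 2 g) q) = 1
      \<and> pd 1 g q \<bullet> pd 2 (pd 2 g) q = 0 \<and> pd 2 (pd 2 g) q \<bullet> n q = 0" if "q \<in> W" "q $ 2 = 0" for q
    using assms(6) that unfolding adapted_coordinates_def Let_def g n by blast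
  interpret pure_frontal_coordinates W g n
  proof
    show "open W" "0 \<in> W" by fact+
    show "smooth_on W g" "smooth_on W n"
      unfolding g n using smooth_on_compose[OF oW WU s\<phi>] sf s\<nu> by auto
    show "norm (n q) = 1" if "q \<in> W" for q
      using fr(2) WU that by (auto simp: n)
    show "pd i g q \<bullet> n q = 0" if "q \<in> W" for q i
    proof -
      have "\<phi> q \<in> U" using WU that by auto
      then show ?thesis
        using fr(1) smooth_on_differentiable[OF s\<phi> that] smooth_on_differentiable[OF sf]
        by (simp add: pd_def g n frechet_derivative_comp)
    qed
    show "pd 2 g q = 0" if "q \<in> W" "q $ 2 = 0" for q using axis that by blast
    show "\<forall>\<^sub>F q in nhds 0. q $ 2 = 0 \<longrightarrow> pd 2 n q = 0"
      unfolding n by (rule normal_v_vanishes_on_axis[OF assms(3,5,6)])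
    show "norm (pd 1 g 0) = 1" "norm (pd 2 (pd 2 g) 0) = 1"
      "pd 1 g 0 \<bullet> pd 2 (pd 2 g) 0 = 0" "pd 2 (pd 2 g) 0 \<bullet> n 0 = 0"
      using axis[OF W0] by simp_all
    have "vector [0, 0] = (0 :: real^2)" by (simp add: vec_eq_iff forall_2)
    then show "tM g n 0 \<noteq> 0" using assms(10) by (simp add: cuspidal_torsion_def)
  qed
  show ?thesis
    using assms(9) eventually_nhds_x_imp_x focal_surface_singular_iff by blast
qed

end
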